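(* Let $\Omega\subset\mathbb{H}^n$ be open, $T>0$, $\Omega_T=(0,T)\times\Omega$, and let $u$ be a smooth function in $\Omega_T$. Then the asymptotic mean value formula $$u(t,x)=\frac{1}{\varepsilon^2}\int_{t-\varepsilon^2}^{t}\left(\frac{1}{|B_\varepsilon|}\int_{B_\varepsilon(x)}\psi(x^{-1}\circ y)\,u(s,y)\,dy\right)ds+o(\varepsilon^2)\quad\text{as }\varepsilon\to0$$ holds for all $(t,x)\in\Omega_T$ if and only if $$u_t(t,x)=M(n)\,\Delta_H u(t,x)\quad\text{in }\Omega_T,$$ where $$M(n)=\begin{cases}\dfrac{2n+2}{2n+4}\cdot\dfrac{(n!!)^2}{(n+1)!!\,(n-1)!!}\cdot\dfrac{\pi}{2}\cdot\dfrac{1}{2n}, & n\text{ odd},\\[3mm] \dfrac{2n+2}{2n+4}\cdot\dfrac{(n!!)^2}{(n+1)!!\,(n-1)!!}\cdot\dfrac{2}{\pi}\cdot\dfrac{1}{2n}, & n\text{ even}.\end{cases}$$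
   Context: $n\ge1$ is an integer. The Heisenberg group $\mathbb{H}^n$ is $\mathbb{R}^{2n+1}$ with points $x=(x_1,\dots,x_{2n},x_{2n+1})=(\overline{x},x_{2n+1})$ and group law $$x^0\circ x=\Big(x_1+x_1^0,\dots,x_{2n}+x_{2n}^0,\;x_{2n+1}+x_{2n+1}^0+2\sum_{i=1}^n(x_ix_{n+i}^0-x_i^0x_{n+i})\Big),$$ so the identity is $0$ and $x^{-1}=-x$. The horizontal vector fields are, for $i=1,\dots,n$, $X_i=\partial_{x_i}+2x_{n+i}\partial_{x_{2n+1}}$ and $X_{n+i}=\partial_{x_{n+i}}-2x_i\partial_{x_{2n+1}}$ (acting in the space variable $x$ on functions of $(t,x)$). The sub-Laplacian is $\Delta_H u=\sum_{i=1}^{2n}X_iX_iu$. The quasi-distance from the origin is $\rho(x)=(|\overline{x}|^4+x_{2n+1}^2)^{1/4}$, where $|\overline x|$ is the Euclidean norm on $\mathbb{R}^{2n}$, and $B_r(x)=\{y\in\mathbb{H}^n:\rho(x^{-1}\circ y)<r\}$. Set $\psi(x)=|\overline{x}|^2/\rho(x)^2$ for $x\neq0$, and let $|B_r|=\int_{B_r(0)}\psi(y)\,dy$ (with $dy$ Lebesgue measure), so that the inner integral in the formula is the $\psi$-weighted average of $u(s,\cdot)$ over $B_\varepsilon(x)$. Double factorials are as usual with $0!!=1$. The formula is understood pointwise, for each $(t,x)$ and $\varepsilon$ small enough that the sets involved lie in $\Omega_T$. *)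

theory Defs
  imports "HOL-Analysis.Analysis" "HOL-Library.Landau_Symbols"
begin

text \<open>
  The Heisenberg group of dimension $2n+1$, where $n$ is the cardinality of the index type.
  A point \<open>((a, b), z)\<close> has \<open>a $ i\<close> $= x_i$, \<open>b $ i\<close> $= x_{n+i}$ and \<open>z\<close> $= x_{2n+1}$, so that
  \<open>fst x\<close> is the horizontal part and \<open>norm (fst x)\<close> its Euclidean norm.
\<close>
type_synonym 'n heisenberg = "((real ^ 'n) \<times> (real ^ 'n)) \<times> real"

definition heis_mult :: "'n::finite heisenberg \<Rightarrow> 'n heisenberg \<Rightarrow> 'n heisenberg"
    (infixl "\<circ>\<^sub>H" 70) where
  "p \<circ>\<^sub>H x =
     (fst x + fst p,
      snd x + snd p
        + 2 * (\<Sum>i\<in>UNIV. fst (fst x) $ i * snd (fst p) $ i - fst (fst p) $ i * snd (fst x) $ i))"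

definition heis_inv :: "'n::finite heisenberg \<Rightarrow> 'n heisenberg" where
  "heis_inv x = - x"

lemma heis_mult_assoc: "(x \<circ>\<^sub>H y) \<circ>\<^sub>H z = x \<circ>\<^sub>H (y \<circ>\<^sub>H z)"
  by (simp add: heis_mult_def algebra_simps sum.distrib sum_subtractf)

lemma heis_mult_zero [simp]: "0 \<circ>\<^sub>H x = x" "x \<circ>\<^sub>H 0 = x"
  by (simp_all add: heis_mult_def prod_eq_iff)

lemma heis_mult_inv [simp]: "heis_inv x \<circ>\<^sub>H x = 0" "x \<circ>\<^sub>H heis_inv x = 0"
  by (simp_all add: heis_mult_def heis_inv_def prod_eq_iff mult.commute)

definition heis_rho :: "'n::finite heisenberg \<Rightarrow> real" where
  "heis_rho x = root 4 (norm (fst x) ^ 4 + (snd x)\<^sup>2)"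

definition heis_ball :: "'n::finite heisenberg \<Rightarrow> real \<Rightarrow> 'n heisenberg set" where
  "heis_ball x r = {y. heis_rho (heis_inv x \<circ>\<^sub>H y) < r}"

text \<open>At the origin, where the quotient is undefined, this has the value 0; a single point does
  not affect the integrals below.\<close>
definition heis_psi :: "'n::finite heisenberg \<Rightarrow> real" where
  "heis_psi x = (norm (fst x))\<^sup>2 / (heis_rho x)\<^sup>2"

text \<open>The quantity $|B_r|$ is the \<open>\<psi>\<close>-weighted, not the Lebesgue, volume of the ball.\<close>
definition heis_ball_vol :: "'n::finite itself \<Rightarrow> real \<Rightarrow> real" where
  "heis_ball_vol _ r = (LINT y:heis_ball (0 :: 'n heisenberg) r|lborel. heis_psi y)"

definition heis_avg :: "('n::finite heisenberg \<Rightarrow> real) \<Rightarrow> 'n heisenberg \<Rightarrow> real \<Rightarrow> real" where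
  "heis_avg f x r =
     1 / heis_ball_vol TYPE('n) r *
       (LINT y:heis_ball x r|lborel. heis_psi (heis_inv x \<circ>\<^sub>H y) * f y)"

definition pderiv_along :: "'a::real_normed_vector \<Rightarrow> ('a \<Rightarrow> real) \<Rightarrow> 'a \<Rightarrow> real" where
  "pderiv_along v f x = deriv (\<lambda>h. f (x + h *\<^sub>R v)) 0"

definition heis_X :: "'n::finite \<Rightarrow> ('n heisenberg \<Rightarrow> real) \<Rightarrow> 'n heisenberg \<Rightarrow> real" where
  "heis_X i f x =
     pderiv_along ((axis i 1, 0), 0) f x + 2 * snd (fst x) $ i * pderiv_along ((0, 0), 1) f x"

text \<open>The fields $X_{n+i}$.\<close>
definition heis_Y :: "'n::finite \<Rightarrow> ('n heisenberg \<Rightarrow> real) \<Rightarrow> 'n heisenberg \<Rightarrow> real" where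
  "heis_Y i f x =
     pderiv_along ((0, axis i 1), 0) f x - 2 * fst (fst x) $ i * pderiv_along ((0, 0), 1) f x"

definition sub_laplacian :: "('n::finite heisenberg \<Rightarrow> real) \<Rightarrow> 'n heisenberg \<Rightarrow> real" where
  "sub_laplacian f x =
     (\<Sum>i\<in>UNIV. heis_X i (heis_X i f) x) + (\<Sum>i\<in>UNIV. heis_Y i (heis_Y i f) x)"

text \<open>\<open>Ck_on k f S\<close>, for open \<open>S\<close>: \<open>f\<close> is $C^k$ on \<open>S\<close>. The values of \<open>f\<close> outside \<open>S\<close> are
  irrelevant.\<close>
primrec Ck_on :: "nat \<Rightarrow> ('a::real_normed_vector \<Rightarrow> real) \<Rightarrow> 'a set \<Rightarrow> bool" where
  "Ck_on 0 f S \<longleftrightarrow> continuous_on S f"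
| "Ck_on (Suc k) f S \<longleftrightarrow>
     (\<forall>x\<in>S. f differentiable (at x)) \<and>
     (\<forall>v. Ck_on k (\<lambda>x. frechet_derivative f (at x) v) S)"

definition smooth_on :: "('a::real_normed_vector \<Rightarrow> real) \<Rightarrow> 'a set \<Rightarrow> bool" where
  "smooth_on f S \<longleftrightarrow> (\<forall>k. Ck_on k f S)"

fun double_fact :: "nat \<Rightarrow> nat" where
  "double_fact 0 = 1"
| "double_fact (Suc 0) = 1"
| "double_fact (Suc (Suc n)) = Suc (Suc n) * double_fact n"

definition mean_value_const :: "nat \<Rightarrow> real" where
  "mean_value_const n =
     (2 * real n + 2) / (2 * real n + 4)
     * ((real (double_fact n))\<^sup>2 / (real (double_fact (n + 1)) * real (double_fact (n - 1))))
     * (if odd n then pi / 2 else 2 / pi)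
     * (1 / (2 * real n))"

end

theory Submission
  imports Defs
begin

text \<open>
  After the substitution \<open>y = x \<circ>\<^sub>H z\<close>, which preserves Lebesgue measure, the inner integral is the
  average of \<open>u (s, x \<circ>\<^sub>H z)\<close> over the ball of radius \<open>\<epsilon>\<close> about the origin with weight \<open>\<psi> z\<close>. Write
  \<open>z = (h, \<tau>)\<close> with horizontal part \<open>h\<close>. Then \<open>x \<circ>\<^sub>H z = x + L h + (0, \<tau>)\<close>, where \<open>L\<close> is linear and maps
  the basis vectors to the values at \<open>x\<close> of the horizontal fields. On the ball \<open>h\<close> has size \<open>\<epsilon>\<close>,
  whereas \<open>\<tau>\<close> and \<open>s - t\<close> have size \<open>\<epsilon>\<^sup>2\<close>, so a Taylor expansion of second order in \<open>h\<close> and of first order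
  in \<open>\<tau>\<close> and \<open>s\<close> is exact up to \<open>o(\<epsilon>\<^sup>2)\<close> (\<open>parabolic_taylor\<close>):
  \<open>u (s, x \<circ>\<^sub>H z) = u (t, x) + D u (L h) + \<tau> D u e + D\<^sup>2 u (L h, L h) / 2 + (s - t) u\<^sub>t + o(\<epsilon>\<^sup>2)\<close>,
  where \<open>e\<close> is the vertical unit vector.

  The weight and the ball depend only on the norm of \<open>h\<close> and on \<open>\<tau>\<^sup>2\<close>. The reflection \<open>z \<mapsto> - z\<close> makes
  the terms linear in \<open>z\<close> average to zero, a sign change of one horizontal coordinate kills the
  mixed products in the quadratic term, and exchanging two horizontal coordinates shows that all
  squares have the same average \<open>c \<epsilon>\<^sup>2\<close> (\<open>ball_weight_linear\<close>, \<open>ball_weight_quadratic\<close>). Since the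
  coefficient of \<open>X\<^sub>i\<close> is constant along the directions in which it differentiates, \<open>X\<^sub>i X\<^sub>i u\<close> is the
  second derivative of \<open>u\<close> along the frozen direction \<open>L e\<^sub>i\<close>, so the sub-Laplacian is the trace of
  \<open>D\<^sup>2 u (L h, L h)\<close> (\<open>sub_laplacian_eq_trace\<close>) and the quadratic term averages to \<open>c \<epsilon>\<^sup>2 \<Delta>\<^sub>H u / 2\<close>. The
  mean of \<open>s - t\<close> over the time interval is \<open>- \<epsilon>\<^sup>2 / 2\<close>. Altogether (\<open>mean_value_expansion\<close>) the
  difference of \<open>u (t, x)\<close> and its average is \<open>(u\<^sub>t - c \<Delta>\<^sub>H u) \<epsilon>\<^sup>2 / 2 + o(\<epsilon>\<^sup>2)\<close>, and this is \<open>o(\<epsilon>\<^sup>2)\<close>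
  exactly when the bracket vanishes.

  It remains to see that \<open>c\<close> is the stated constant. The integrals of \<open>\<bar>h\<bar>\<^sup>a / \<rho>\<^sup>2\<close> over balls are
  integrals of a power of \<open>\<rho>\<close> against a measure that is homogeneous under the dilations
  \<open>(h, \<tau>) \<mapsto> (r h, r\<^sup>2 \<tau>)\<close>. Such a measure is determined by one constant, and that constant can be read
  off from any radial integrand. The choice \<open>exp (- \<rho>\<^sup>4) = exp (- \<bar>h\<bar>\<^sup>4) exp (- \<tau>\<^sup>2)\<close> factorizes and gives
  Gamma values (\<open>nn_integral_gauge4_ball\<close>), whose quotient obeys the same two-step recursion as the
  quotient of double factorials (\<open>Gamma_quotient_double_fact\<close>).
\<close>

section \<open>Measures whose distribution function is a power\<close>

lemma borel_measurable_fst [measurable (raw)]: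
  fixes f :: "'a \<Rightarrow> 'b::second_countable_topology \<times> 'c::second_countable_topology"
  assumes "f \<in> M \<rightarrow>\<^sub>M borel"
  shows "(\<lambda>x. fst (f x)) \<in> M \<rightarrow>\<^sub>M borel"
  by (rule measurable_compose[OF assms borel_measurable_continuous_onI]) (intro continuous_intros)

lemma borel_measurable_snd [measurable (raw)]:
  fixes f :: "'a \<Rightarrow> 'b::second_countable_topology \<times> 'c::second_countable_topology"
  assumes "f \<in> M \<rightarrow>\<^sub>M borel"
  shows "(\<lambda>x. snd (f x)) \<in> M \<rightarrow>\<^sub>M borel"
  by (rule measurable_compose[OF assms borel_measurable_continuous_onI]) (intro continuous_intros)

lemma nn_integral_powr_below:
  assumes "d > 0" "C \<ge> 0" "t > 0"
  shows "(\<integral>\<^sup>+s. ennreal (indicator {0..} s * (C * d * s powr (d - 1))) * indicator {..<t} s \<partial>lborel)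
           = ennreal (C * t powr d)"
proof -
  have "((\<lambda>s. s powr (d - 1)) has_integral (t powr (d - 1 + 1) / (d - 1 + 1))) {0..t}"
    using assms by (intro has_integral_powr_from_0) auto
  then have "((\<lambda>s. (C * d) * s powr (d - 1)) has_integral (C * d) * (t powr d / d)) {0..t}"
    by (intro has_integral_mult_right) simp
  then have "(\<integral>\<^sup>+s. ennreal (indicator {0..t} s * (C * d * s powr (d - 1))) \<partial>lborel) = ennreal (C * t powr d)"
    using assms by (subst nn_integral_has_integral_lebesgue) auto
  moreover have "AE s in lborel. s \<noteq> t"
    by (rule AE_lborel_singleton)
  then have "AE s in lborel. ennreal (indicator {0..} s * (C * d * s powr (d - 1))) * indicator {..<t} s
      = ennreal (indicator {0..t} s * (C * d * s powr (d - 1)))"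
    by eventually_elim (auto split: split_indicator)
  ultimately show ?thesis
    by (simp add: nn_integral_cong_AE)
qed

text \<open>
  Radial integration for a measure with weight \<open>w\<close>: the push-forward under \<open>R\<close> has distribution
  function \<open>C t\<^sup>d\<close>, hence density \<open>C d t\<^sup>d\<^sup>-\<^sup>1\<close>, because a measure on the line is determined by its values on
  the half-lines \<open>{..<t}\<close>. This replaces polar coordinates throughout.
\<close>

lemma nn_integral_power_distribution:
  fixes R :: "'a \<Rightarrow> real" and w :: "'a \<Rightarrow> ennreal" and g :: "real \<Rightarrow> ennreal"
  assumes [measurable]: "w \<in> borel_measurable M" "R \<in> borel_measurable M" "g \<in> borel_measurable borel"
    and R: "\<And>z. z \<in> space M \<Longrightarrow> 0 \<le> R z"
    and C: "C \<ge> 0" and d: "d > 0"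
    and cdf: "\<And>t. t > 0 \<Longrightarrow> (\<integral>\<^sup>+z. w z * indicator {..<t} (R z) \<partial>M) = ennreal (C * t powr d)"
  shows "(\<integral>\<^sup>+z. w z * g (R z) \<partial>M)
           = (\<integral>\<^sup>+t. ennreal (indicator {0..} t * (C * d * t powr (d - 1))) * g t \<partial>lborel)"
proof -
  let ?N1 = "distr (density M w) borel R"
  let ?N2 = "density lborel (\<lambda>t. ennreal (indicator {0..} t * (C * d * t powr (d - 1))))"
  have N1: "emeasure ?N1 {..<t} = (\<integral>\<^sup>+z. w z * indicator {..<t} (R z) \<partial>M)" for t
    by (subst emeasure_distr, simp, simp, subst emeasure_density)
       (auto intro!: nn_integral_cong split: split_indicator)
  have N2: "emeasure ?N2 {..<t}
      = (\<integral>\<^sup>+s. ennreal (indicator {0..} s * (C * d * s powr (d - 1))) * indicator {..<t} s \<partial>lborel)" for t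
    by (subst emeasure_density) auto
  have eq: "emeasure ?N1 {..<t} = emeasure ?N2 {..<t}" for t
  proof (cases "t > 0")
    case True
    then show ?thesis unfolding N1 N2 using cdf nn_integral_powr_below d C by simp
  next
    case False
    then have "emeasure ?N1 {..<t} = 0" unfolding N1
      by (subst nn_integral_0_iff_AE) (auto intro!: AE_I2 dest!: R split: split_indicator)
    moreover have "emeasure ?N2 {..<t} = 0" unfolding N2
      using False by (subst nn_integral_0_iff_AE) (auto intro!: AE_I2 split: split_indicator)
    ultimately show ?thesis by simp
  qed
  have "?N1 = ?N2"
  proof (rule measure_eqI_generator_eq[where E = "range lessThan" and \<Omega> = UNIV and A = "\<lambda>i. {..<real i}"])
    show "Int_stable (range (lessThan :: real \<Rightarrow> _))"
    proof (rule Int_stableI)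
      fix a b :: "real set" assume "a \<in> range lessThan" "b \<in> range lessThan"
      then obtain x y where "a = {..<x}" "b = {..<y}" by auto
      then have "a \<inter> b = {..<min x y}" by auto
      then show "a \<inter> b \<in> range lessThan" by blast
    qed
    have "borel = sigma UNIV (range (lessThan :: real \<Rightarrow> _))"
      using borel_eq_lessThan[where 'a = real] by (simp add: lessThan_def eucl_less_def)
    then have "sets (borel :: real measure) = sigma_sets UNIV (range lessThan)"
      by (metis sets_measure_of subset_UNIV Pow_UNIV)
    then show "sets ?N1 = sigma_sets UNIV (range lessThan)"
      "sets ?N2 = sigma_sets UNIV (range lessThan)" by auto
    show "(\<Union>i. {..<real i}) = UNIV"
      by (auto simp: reals_Archimedean2)
    fix i show "emeasure ?N1 {..<real i} \<noteq> \<infinity>"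
    proof (cases "i = 0")
      case True
      have "(\<lambda>s. ennreal (indicator {0..} s * (C * d * s powr (d - 1))) * indicator {..<0} s) = (\<lambda>_. 0)"
        by (auto split: split_indicator)
      then show ?thesis unfolding eq N2 using True by simp
    next
      case False
      then show ?thesis unfolding eq N2 using nn_integral_powr_below[OF d C, of "real i"] by simp
    qed
  qed (use eq in auto)
  then have "integral\<^sup>N ?N1 g = integral\<^sup>N ?N2 g" by simp
  then show ?thesis
    by (simp add: nn_integral_distr nn_integral_density)
qed

text \<open>
  Taking a power of the norm as the radial variable lets the later integrands be \<open>exp (- t)\<close>, so that
  Gamma integrals appear without a change of variables.
\<close>

lemma nn_integral_norm_power:
  fixes g :: "real \<Rightarrow> ennreal"
  assumes [measurable]: "g \<in> borel_measurable borel" and k: "k > 0"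
  defines "V \<equiv> unit_ball_vol (real DIM('a)) :: real" and "d \<equiv> real DIM('a) / real k"
  shows "(\<integral>\<^sup>+z. g (norm (z :: 'a::euclidean_space) ^ k) \<partial>lborel)
           = (\<integral>\<^sup>+t. ennreal (indicator {0..} t * (V * d * t powr (d - 1))) * g t \<partial>lborel)"
proof -
  have "(\<integral>\<^sup>+z. 1 * g (norm (z::'a) ^ k) \<partial>lborel)
           = (\<integral>\<^sup>+t. ennreal (indicator {0..} t * (V * d * t powr (d - 1))) * g t \<partial>lborel)"
  proof (rule nn_integral_power_distribution)
    fix t :: real assume t: "t > 0"
    have ball: "norm z ^ k < t \<longleftrightarrow> norm z < root k t" for z :: 'a
      using real_root_less_iff[OF k, of "norm z ^ k" t] k by (simp add: real_root_power_cancel)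
    have "(\<integral>\<^sup>+z. 1 * indicator {..<t} (norm (z::'a) ^ k) \<partial>lborel) = (\<integral>\<^sup>+z. indicator (ball (0::'a) (root k t)) z \<partial>lborel)"
      by (intro nn_integral_cong) (auto simp: ball split: split_indicator)
    also have "\<dots> = emeasure lborel (ball (0::'a) (root k t))"
      by simp
    also have "\<dots> = ennreal (V * root k t ^ DIM('a))"
      using t k by (subst emeasure_ball) (auto simp: V_def)
    also have "root k t ^ DIM('a) = t powr d"
      using t k by (simp add: root_powr_inverse d_def powr_powr powr_realpow[symmetric])
    finally show "(\<integral>\<^sup>+z. 1 * indicator {..<t} (norm (z::'a) ^ k) \<partial>lborel) = ennreal (V * t powr d)" .
  qed (use k in \<open>auto simp: V_def d_def\<close>)
  then show ?thesis by simp
qed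

section \<open>Integrals over gauge balls\<close>

text \<open>
  The fourth power of the homogeneous gauge \<open>\<rho>\<close>. It is polynomial, and \<open>exp (- \<rho>\<^sup>4)\<close> is a product of
  a function of the horizontal part and a Gaussian in the vertical coordinate.
\<close>

definition gauge4 :: "'e::euclidean_space \<times> real \<Rightarrow> real" where
  "gauge4 z = norm (fst z) ^ 4 + (snd z)\<^sup>2"

lemma gauge4_nonneg: "0 \<le> gauge4 z"
  by (simp add: gauge4_def)

lemma borel_measurable_gauge4 [measurable]: "gauge4 \<in> borel_measurable borel"
  unfolding gauge4_def[abs_def] by measurable

lemma nn_integral_dilation:
  fixes f :: "'e::euclidean_space \<times> real \<Rightarrow> ennreal"
  assumes [measurable]: "f \<in> borel_measurable borel" and r: "r > 0"
  shows "(\<integral>\<^sup>+z. f z \<partial>lborel)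
           = ennreal (r ^ (DIM('e) + 2)) * (\<integral>\<^sup>+z. f (r *\<^sub>R fst z, r\<^sup>2 * snd z) \<partial>lborel)"
proof -
  have m: "f \<in> borel_measurable (lborel \<Otimes>\<^sub>M lborel)"
    by (simp add: lborel_prod)
  have "(\<integral>\<^sup>+z. f z \<partial>lborel) = (\<integral>\<^sup>+x. \<integral>\<^sup>+y. f (x, y) \<partial>lborel \<partial>lborel)"
    using lborel.nn_integral_fst[OF m] by (simp add: lborel_prod)
  also have "\<dots> = (\<integral>\<^sup>+x. ennreal (r\<^sup>2) * (\<integral>\<^sup>+y. f (x, r\<^sup>2 * y) \<partial>lborel) \<partial>lborel)"
    using r nn_integral_real_affine[of "\<lambda>y. f (_, y)" "r\<^sup>2" 0] by simp
  also have "\<dots> = ennreal (r ^ DIM('e)) *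
      (\<integral>\<^sup>+x. ennreal (r\<^sup>2) * (\<integral>\<^sup>+y. f (r *\<^sub>R x, r\<^sup>2 * y) \<partial>lborel) \<partial>lborel)"
    using r by (subst lborel_affine[of r 0])
      (simp, simp add: nn_integral_density nn_integral_distr nn_integral_cmult, rule mult.left_commute)
  also have "\<dots> = ennreal (r ^ (DIM('e) + 2)) * (\<integral>\<^sup>+x. \<integral>\<^sup>+y. f (r *\<^sub>R x, r\<^sup>2 * y) \<partial>lborel \<partial>lborel)"
    using r by (subst power_add, subst ennreal_mult) (auto simp: nn_integral_cmult mult.assoc)
  also have "(\<integral>\<^sup>+x. \<integral>\<^sup>+y. f (r *\<^sub>R x, r\<^sup>2 * y) \<partial>lborel \<partial>lborel)
      = (\<integral>\<^sup>+z. f (r *\<^sub>R fst z, r\<^sup>2 * snd z) \<partial>lborel)"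
    using lborel.nn_integral_fst[of "\<lambda>z. f (r *\<^sub>R fst z, r\<^sup>2 * snd z)" "lborel :: 'e measure"]
    by (simp add: lborel_prod)
  finally show ?thesis .
qed

lemma gauge4_dilation: "gauge4 (r *\<^sub>R fst z, r\<^sup>2 * snd z) = r ^ 4 * gauge4 z"
  by (simp add: gauge4_def power_mult_distrib algebra_simps)

text \<open>
  By dilation, the weighted volume of a gauge ball is a power of its radius, so all integrals of
  radial functions against the weight \<open>\<bar>h\<bar>\<^sup>a\<close> are known up to the one constant \<open>C\<close>, the weighted volume of
  the unit ball. The exponent comes from the homogeneous dimension \<open>DIM + 2\<close> and the degree of the
  weight, divided by 4 because the radial variable is \<open>\<rho>\<^sup>4\<close>.
\<close>

lemma nn_integral_gauge4:
  fixes a :: nat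
  assumes a: "a > 0"
  defines "d \<equiv> (real DIM('e::euclidean_space) + real a + 2) / 4"
  shows "\<exists>C\<ge>0. \<forall>g \<in> borel_measurable borel.
           (\<integral>\<^sup>+z. ennreal (norm (fst z) ^ a) * g (gauge4 (z :: 'e \<times> real)) \<partial>lborel)
             = (\<integral>\<^sup>+t. ennreal (indicator {0..} t * (C * d * t powr (d - 1))) * g t \<partial>lborel)"
proof -
  define K where "K t = (\<integral>\<^sup>+z. ennreal (norm (fst z) ^ a) * indicator {..<t} (gauge4 (z :: 'e \<times> real)) \<partial>lborel)" for t
  define C where "C = enn2real (K 1)"
  have fin: "K 1 < \<infinity>"
  proof -
    have "K 1 \<le> (\<integral>\<^sup>+z. indicator (cball (0 :: 'e \<times> real) 2) z \<partial>lborel)"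
      unfolding K_def
    proof (intro nn_integral_mono)
      fix z :: "'e \<times> real"
      have "norm (fst z) < 1" "\<bar>snd z\<bar> < 1" if "gauge4 z < 1"
      proof -
        have "norm (fst z) ^ 4 < 1" "(snd z)\<^sup>2 < 1"
          using that zero_le_power2[of "snd z"] zero_le_power[OF norm_ge_zero[of "fst z"], of 4]
          unfolding gauge4_def by linarith+
        then show "norm (fst z) < 1" "\<bar>snd z\<bar> < 1"
          by (meson linorder_not_less norm_ge_zero one_le_power)
             (use \<open>(snd z)\<^sup>2 < 1\<close> in \<open>simp add: abs_square_less_1\<close>)
      qed
      moreover have "norm z \<le> norm (fst z) + norm (snd z)"
        by (metis norm_Pair_le prod.collapse)
      ultimately show "ennreal (norm (fst z) ^ a) * indicator {..<1} (gauge4 z) \<le> indicator (cball 0 2) z"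
        by (auto split: split_indicator intro!: power_le_one)
    qed
    also have "\<dots> < \<infinity>"
      using emeasure_bounded_finite[of "cball (0 :: 'e \<times> real) 2"] by simp
    finally show ?thesis .
  qed
  have cdf: "K t = ennreal (C * t powr d)" if t: "t > 0" for t
  proof -
    define r where "r = t powr (1/4)"
    have r: "r > 0" "r ^ 4 = t"
      using t by (auto simp: r_def powr_powr powr_realpow[symmetric])
    have "K t = ennreal (r ^ (DIM('e) + 2)) *
        (\<integral>\<^sup>+z. ennreal (r ^ a) * (ennreal (norm (fst z) ^ a) * indicator {..<1} (gauge4 (z :: 'e \<times> real))) \<partial>lborel)"
      unfolding K_def using r t
      by (subst nn_integral_dilation[OF _ r(1)], simp)
         (rule arg_cong2[where f = "(*)", OF refl], rule nn_integral_cong,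
          auto simp: gauge4_dilation power_mult_distrib ennreal_mult split: split_indicator)
    also have "\<dots> = ennreal (r ^ (DIM('e) + 2)) * (ennreal (r ^ a) * K 1)"
      unfolding K_def by (subst nn_integral_cmult) auto
    also have "K 1 = ennreal C"
      using fin by (simp add: C_def)
    also have "ennreal (r ^ (DIM('e) + 2)) * (ennreal (r ^ a) * ennreal C) = ennreal (C * r ^ (DIM('e) + 2 + a))"
      using r by (simp add: ennreal_mult'[symmetric] C_def power_add mult_ac)
    also have "r ^ (DIM('e) + 2 + a) = (t powr (1/4)) powr real (DIM('e) + 2 + a)"
      using t by (subst powr_realpow) (auto simp: r_def)
    also have "\<dots> = t powr d"
      unfolding powr_powr by (simp add: d_def add_ac)
    finally show ?thesis .
  qed
  show ?thesis
  proof (intro exI[of _ C] conjI ballI)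
    fix g :: "real \<Rightarrow> ennreal" assume [measurable]: "g \<in> borel_measurable borel"
    show "(\<integral>\<^sup>+z. ennreal (norm (fst z) ^ a) * g (gauge4 (z :: 'e \<times> real)) \<partial>lborel)
             = (\<integral>\<^sup>+t. ennreal (indicator {0..} t * (C * d * t powr (d - 1))) * g t \<partial>lborel)"
    proof (rule nn_integral_power_distribution)
      show "C \<ge> 0" by (simp add: C_def)
      show "d > 0" by (simp add: d_def)
      show "(\<integral>\<^sup>+z. ennreal (norm (fst z) ^ a) * indicator {..<t} (gauge4 (z :: 'e \<times> real)) \<partial>lborel)
          = ennreal (C * t powr d)" if "t > 0" for t
        using cdf[OF that] unfolding K_def .
    qed (simp_all add: gauge4_nonneg)
  qed (simp add: C_def)
qed

lemma nn_integral_powr_exp: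
  assumes "s > 0" "B \<ge> 0"
  shows "(\<integral>\<^sup>+t. ennreal (indicator {0..} t * (B * t powr (s - 1))) * ennreal (exp (- t)) \<partial>lborel)
           = ennreal (B * Gamma s)"
proof -
  have "(\<integral>\<^sup>+t. ennreal (indicator {0..} t * (B * t powr (s - 1))) * ennreal (exp (- t)) \<partial>lborel)
      = (\<integral>\<^sup>+t. ennreal B * ennreal (indicator {0..} t * t powr (s - 1) / exp t) \<partial>lborel)"
    using assms by (intro nn_integral_cong)
      (auto simp: ennreal_mult'[symmetric] exp_minus field_simps split: split_indicator)
  also have "\<dots> = ennreal B * ennreal (Gamma s)"
    using assms by (subst nn_integral_cmult) (auto simp: Gamma_conv_nn_integral_real)
  finally show ?thesis
    using assms by (simp add: ennreal_mult')
qed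

lemma power4_powr:
  assumes "x \<ge> 0" "a > 0"
  shows "(x ^ 4) powr (real a / 4) = x ^ a"
proof (cases "x = 0")
  case False
  then have "x > 0" using assms by simp
  have "(x ^ 4) powr (real a / 4) = (x powr real 4) powr (real a / 4)"
    using \<open>x > 0\<close> by (subst powr_realpow) auto
  also have "\<dots> = x powr real a"
    unfolding powr_powr by simp
  finally show ?thesis
    using \<open>x > 0\<close> by (simp add: powr_realpow)
qed (use assms in auto)

lemma nn_integral_norm_power_exp:
  assumes a: "a > 0"
  defines "D \<equiv> real DIM('e::euclidean_space)"
  shows "(\<integral>\<^sup>+x. ennreal (norm (x :: 'e) ^ a * exp (- (norm x ^ 4))) \<partial>lborel)
           = ennreal (unit_ball_vol D * (D / 4) * Gamma ((D + real a) / 4))"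
proof -
  have D: "D > 0" by (simp add: D_def)
  have "(norm x ^ 4) powr (real a / 4) = norm x ^ a" for x :: 'e
    using a by (simp add: power4_powr)
  then have "(\<integral>\<^sup>+x. ennreal (norm (x :: 'e) ^ a * exp (- (norm x ^ 4))) \<partial>lborel)
      = (\<integral>\<^sup>+x. ennreal ((norm (x :: 'e) ^ 4) powr (real a / 4) * exp (- (norm x ^ 4))) \<partial>lborel)"
    by simp
  also have "\<dots> = (\<integral>\<^sup>+t. ennreal (indicator {0..} t * (unit_ball_vol D * (D / 4) * t powr (D / 4 - 1)))
       * ennreal (t powr (real a / 4) * exp (- t)) \<partial>lborel)"
    using nn_integral_norm_power[where 'a = 'e and k = 4 and g = "\<lambda>t. ennreal (t powr (real a / 4) * exp (- t))"]
    by (simp add: D_def)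
  also have "\<dots> = (\<integral>\<^sup>+t. ennreal (indicator {0..} t * (unit_ball_vol D * (D / 4) * t powr ((D + real a) / 4 - 1)))
       * ennreal (exp (- t)) \<partial>lborel)"
  proof -
    have "t powr ((D + real a) / 4 - 1) = t powr (D / 4 - 1) * t powr (real a / 4)" for t
      unfolding powr_add[symmetric] by (simp add: add_divide_distrib algebra_simps)
    then show ?thesis using D by (intro nn_integral_cong)
      (auto simp: ennreal_mult'[symmetric] mult_ac split: split_indicator)
  qed
  also have "\<dots> = ennreal (unit_ball_vol D * (D / 4) * Gamma ((D + real a) / 4))"
    using D by (intro nn_integral_powr_exp) auto
  finally show ?thesis .
qed

lemma nn_integral_real_gaussian:
  "(\<integral>\<^sup>+y. ennreal (exp (- (y::real)\<^sup>2)) \<partial>lborel) = ennreal (Gamma (1 / 2))"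
proof -
  have "(\<integral>\<^sup>+y. ennreal (exp (- (y::real)\<^sup>2)) \<partial>lborel)
     = (\<integral>\<^sup>+t. ennreal (indicator {0..} t * (1 * t powr (1 / 2 - 1))) * ennreal (exp (- t)) \<partial>lborel)"
    using nn_integral_norm_power[where 'a = real and k = 2 and g = "\<lambda>t. ennreal (exp (- t))"]
    by simp
  also have "\<dots> = ennreal (1 * Gamma (1 / 2))"
    by (rule nn_integral_powr_exp) auto
  finally show ?thesis by simp
qed

text \<open>
  The constant \<open>C\<close> of \<open>nn_integral_gauge4\<close> is found by testing it with \<open>exp (- t)\<close>, where the integral
  factorizes by Tonelli; then it is used with \<open>t\<^sup>-\<^sup>1\<^sup>/\<^sup>2\<close> cut off at \<open>r\<^sup>4\<close>. Since \<open>\<kappa>\<close> does not depend on \<open>a\<close> and \<open>r\<close>,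
  it cancels in the quotient of the cases \<open>a = 2\<close> and \<open>a = 4\<close>, which are the weighted volume and the
  second moment of the ball.
\<close>

lemma nn_integral_gauge4_ball:
  defines "D \<equiv> real DIM('e::euclidean_space)"
  shows "\<exists>\<kappa>>0. \<forall>a>0. \<forall>r>0.
     (\<integral>\<^sup>+z. ennreal (norm (fst z) ^ a / sqrt (gauge4 z) * indicator {..<r ^ 4} (gauge4 (z :: 'e \<times> real))) \<partial>lborel)
       = ennreal (\<kappa> * Gamma ((D + real a) / 4) / ((D + real a) / 4 * Gamma ((D + real a) / 4 + 1 / 2)) * r ^ (DIM('e) + a))"
proof (intro exI[of _ "unit_ball_vol D * (D / 4) * Gamma (1 / 2)"] conjI allI impI)
  define \<kappa> where "\<kappa> = unit_ball_vol D * (D / 4) * Gamma (1 / 2)"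
  have D: "D > 0" by (simp add: D_def)
  then show "unit_ball_vol D * (D / 4) * Gamma (1 / 2) > 0" by auto
  fix a :: nat and r :: real assume a: "a > 0" and r: "r > 0"
  define d where "d = (D + real a + 2) / 4"
  have d: "d > 0" "d - 1/2 > 0" using D a by (auto simp: d_def)
  have d_shift: "d = (D + real a) / 4 + 1 / 2" by (simp add: d_def add_divide_distrib)
  have Gd: "Gamma d > 0" using d by simp
  obtain C where C: "C \<ge> 0" and radial: "\<And>g. g \<in> borel_measurable borel \<Longrightarrow>
           (\<integral>\<^sup>+z. ennreal (norm (fst z) ^ a) * g (gauge4 (z :: 'e \<times> real)) \<partial>lborel)
             = (\<integral>\<^sup>+t. ennreal (indicator {0..} t * (C * d * t powr (d - 1))) * g t \<partial>lborel)"
    using nn_integral_gauge4[OF a, where 'e = 'e] unfolding d_def D_def by blast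
  \<comment> \<open>Testing with the exponential determines the constant.\<close>
  have "ennreal (C * d * Gamma d)
      = (\<integral>\<^sup>+z. ennreal (norm (fst z) ^ a) * ennreal (exp (- gauge4 (z :: 'e \<times> real))) \<partial>lborel)"
    using radial[of "\<lambda>t. ennreal (exp (- t))"] nn_integral_powr_exp[of d "C * d"] C d by simp
  also have "\<dots> = (\<integral>\<^sup>+x. \<integral>\<^sup>+y. ennreal (norm (x :: 'e) ^ a) * ennreal (exp (- gauge4 (x, y))) \<partial>lborel \<partial>lborel)"
    by (subst lborel.nn_integral_fst[symmetric, of _ "lborel :: 'e measure", unfolded lborel_prod]) auto
  also have "\<dots> = (\<integral>\<^sup>+x. \<integral>\<^sup>+y. ennreal (norm (x :: 'e) ^ a * exp (- (norm x ^ 4))) * ennreal (exp (- y\<^sup>2)) \<partial>lborel \<partial>lborel)"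
    by (intro nn_integral_cong)
       (auto simp: gauge4_def exp_add[symmetric] exp_diff ennreal_mult'[symmetric] exp_minus field_simps)
  also have "\<dots> = ennreal (unit_ball_vol D * (D / 4) * Gamma ((D + real a) / 4)) * ennreal (Gamma (1/2))"
    using nn_integral_norm_power_exp[OF a, where 'e = 'e]
    by (simp add: nn_integral_cmult nn_integral_multc nn_integral_real_gaussian D_def)
  also have "\<dots> = ennreal (\<kappa> * Gamma ((D + real a) / 4))"
    using D by (simp add: ennreal_mult'[symmetric] \<kappa>_def mult_ac)
  finally have "C * d * Gamma d = \<kappa> * Gamma ((D + real a) / 4)"
    using C d D by (subst (asm) ennreal_inj) (auto simp: \<kappa>_def)
  then have C_eq: "C * d = \<kappa> * Gamma ((D + real a) / 4) / Gamma d"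
    using Gd by (metis nonzero_eq_divide_eq less_irrefl)
  have inv_sqrt: "gauge4 z powr (- 1/2) = 1 / sqrt (gauge4 z)" for z :: "'e \<times> real"
    using powr_minus[of "gauge4 z" "1/2"] powr_half_sqrt[OF gauge4_nonneg[of z]] by (simp add: inverse_eq_divide)
  have powr_shift: "t powr (d - 1) * t powr - (1 / 2) = t powr (d - 3 / 2)" for t
    unfolding powr_add[symmetric] by (simp add: algebra_simps)
  have "(\<integral>\<^sup>+z. ennreal (norm (fst z) ^ a / sqrt (gauge4 z) * indicator {..<r ^ 4} (gauge4 (z :: 'e \<times> real))) \<partial>lborel)
     = (\<integral>\<^sup>+z. ennreal (norm (fst z) ^ a) * ennreal (gauge4 z powr (- 1/2) * indicator {..<r ^ 4} (gauge4 (z :: 'e \<times> real))) \<partial>lborel)"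
    by (intro nn_integral_cong)
       (subst inv_sqrt, simp add: ennreal_mult'[symmetric])
  also have "\<dots> = (\<integral>\<^sup>+t. ennreal (indicator {0..} t * (C * d * t powr (d - 1))) *
      ennreal (t powr (- 1/2) * indicator {..<r ^ 4} t) \<partial>lborel)"
    by (rule radial) auto
  also have "\<dots> = (\<integral>\<^sup>+t. ennreal (indicator {0..} t * (C * d / (d - 1/2) * (d - 1/2) * t powr (d - 1/2 - 1))) *
      indicator {..<r ^ 4} t \<partial>lborel)"
    using d C by (intro nn_integral_cong)
       (auto simp: ennreal_mult'[symmetric] powr_shift split: split_indicator)
  also have "\<dots> = ennreal (C * d / (d - 1/2) * (r ^ 4) powr (d - 1/2))"
    using d C r by (intro nn_integral_powr_below) auto
  also have "(r ^ 4) powr (d - 1/2) = r ^ (DIM('e) + a)"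
    using power4_powr[of r "DIM('e) + a"] r a by (simp add: d_def D_def add_divide_distrib)
  also have "C * d / (d - 1/2) = \<kappa> * Gamma ((D + real a) / 4) / ((D + real a) / 4 * Gamma ((D + real a) / 4 + 1 / 2))"
    unfolding C_eq unfolding d_shift by (simp only: add_diff_cancel_right' divide_divide_eq_left mult.commute)
  finally show "(\<integral>\<^sup>+z. ennreal (norm (fst z) ^ a / sqrt (gauge4 z) * indicator {..<r ^ 4} (gauge4 (z :: 'e \<times> real))) \<partial>lborel)
       = ennreal (unit_ball_vol D * (D / 4) * Gamma (1 / 2) * Gamma ((D + real a) / 4) / ((D + real a) / 4 * Gamma ((D + real a) / 4 + 1 / 2)) * r ^ (DIM('e) + a))"
    unfolding \<kappa>_def .
qed

section \<open>The constant as a quotient of Gamma values\<close>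

text \<open>
  Truncated subtraction makes this hold at \<open>n = 0\<close> as well, which allows the induction below to start there.
\<close>

lemma double_fact_step: "double_fact (n + 1) = (n + 1) * double_fact (n - 1)"
  by (cases n) auto

lemma Gamma_step: "(x::real) > 0 \<Longrightarrow> Gamma (x + 1) = x * Gamma x"
  by (rule Gamma_plus1) (auto elim!: nonpos_Ints_cases)

text \<open>
  Wallis' quotient: under \<open>n \<mapsto> n + 2\<close> both sides are multiplied by \<open>(n + 2)\<^sup>2 / ((n + 3) (n + 1))\<close>, so the
  parity of \<open>n\<close> is only visible in the two initial values, which come from \<open>\<Gamma>(1/2)\<^sup>2 = \<pi>\<close>.
\<close>

lemma Gamma_quotient_double_fact:
  "(Gamma ((real n + 2) / 2))\<^sup>2 / (Gamma ((real n + 3) / 2) * Gamma ((real n + 1) / 2))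
     = (real (double_fact n))\<^sup>2 / (real (double_fact (n + 1)) * real (double_fact (n - 1)))
        * (if odd n then pi / 2 else 2 / pi)"
proof (induction n rule: double_fact.induct)
  case 1
  have "Gamma (3 / 2 :: real) = sqrt pi / 2"
    using Gamma_step[of "1/2"] by (simp add: Gamma_one_half_real)
  note G = this
  show ?case
    by (simp add: G Gamma_one_half_real)
next
  case 2
  have "Gamma (3 / 2 :: real) = sqrt pi / 2"
    using Gamma_step[of "1/2"] by (simp add: Gamma_one_half_real)
  have "Gamma (2 :: real) = 1"
    using Gamma_step[of 1] by simp
  note G = this \<open>Gamma (3 / 2 :: real) = sqrt pi / 2\<close>
  show ?case
    by (simp add: G power2_eq_square)
next
  case (3 n)
  let ?q = "(real n + 2)\<^sup>2 / ((real n + 3) * (real n + 1))"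
  have G: "Gamma ((real n + 4) / 2) = (real n + 2) / 2 * Gamma ((real n + 2) / 2)"
    "Gamma ((real n + 5) / 2) = (real n + 3) / 2 * Gamma ((real n + 3) / 2)"
    "Gamma ((real n + 3) / 2) = (real n + 1) / 2 * Gamma ((real n + 1) / 2)"
  proof -
    have e: "(real n + 4) / 2 = (real n + 2) / 2 + 1" "(real n + 5) / 2 = (real n + 3) / 2 + 1"
      "(real n + 3) / 2 = (real n + 1) / 2 + 1" by simp_all
    show "Gamma ((real n + 4) / 2) = (real n + 2) / 2 * Gamma ((real n + 2) / 2)"
      unfolding e(1) by (rule Gamma_step) simp
    show "Gamma ((real n + 5) / 2) = (real n + 3) / 2 * Gamma ((real n + 3) / 2)"
      unfolding e(2) by (rule Gamma_step) simp
    show "Gamma ((real n + 3) / 2) = (real n + 1) / 2 * Gamma ((real n + 1) / 2)"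
      unfolding e(3) by (rule Gamma_step) simp
  qed
  have "(Gamma ((real (Suc (Suc n)) + 2) / 2))\<^sup>2
      / (Gamma ((real (Suc (Suc n)) + 3) / 2) * Gamma ((real (Suc (Suc n)) + 1) / 2))
      = (Gamma ((real n + 4) / 2))\<^sup>2 / (Gamma ((real n + 5) / 2) * Gamma ((real n + 3) / 2))"
    by (simp add: add_ac)
  also have "\<dots> = ((real n + 2) / 2 * Gamma ((real n + 2) / 2))\<^sup>2
      / ((real n + 3) / 2 * Gamma ((real n + 3) / 2) * ((real n + 1) / 2 * Gamma ((real n + 1) / 2)))"
    unfolding G(1,2) unfolding G(3)[symmetric] by (rule refl)
  also have "\<dots> = ?q * ((Gamma ((real n + 2) / 2))\<^sup>2 / (Gamma ((real n + 3) / 2) * Gamma ((real n + 1) / 2)))"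
    by (simp add: power_mult_distrib power_divide)
  also have "\<dots> = ?q * ((real (double_fact n))\<^sup>2 / (real (double_fact (n + 1)) * real (double_fact (n - 1)))
        * (if odd n then pi / 2 else 2 / pi))"
    by (simp only: "3.IH")
  also have "\<dots> = (real (double_fact (Suc (Suc n))))\<^sup>2
      / (real (double_fact (Suc (Suc n) + 1)) * real (double_fact (Suc (Suc n) - 1)))
        * (if odd (Suc (Suc n)) then pi / 2 else 2 / pi)"
  proof -
    have "real (double_fact (Suc (Suc n))) = (real n + 2) * real (double_fact n)"
      "real (double_fact (Suc (Suc n) + 1)) = (real n + 3) * real (double_fact (n + 1))"
      "real (double_fact (Suc (Suc n) - 1)) = (real n + 1) * real (double_fact (n - 1))"
      using double_fact_step[of n] by (simp_all add: algebra_simps)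
    note df = this
    show ?thesis
      unfolding df by (simp add: power_mult_distrib mult_ac)
  qed
  finally show ?case .
qed

text \<open>
  The form in which the constant arises: numerator and denominator are the values of
  \<open>nn_integral_gauge4_ball\<close> for \<open>a = 4\<close> and \<open>a = 2\<close> in horizontal dimension \<open>2 n\<close>, without the common factor.
\<close>

lemma mean_value_const_Gamma:
  fixes n :: nat
  defines "x \<equiv> (real n + 1) / 2"
  shows "mean_value_const n
     = (Gamma (x + 1 / 2) / ((x + 1 / 2) * Gamma (x + 1))) / (Gamma x / (x * Gamma (x + 1 / 2))) / (2 * real n)"
proof -
  have "mean_value_const n = (2 * real n + 2) / (2 * real n + 4) *
     ((Gamma ((real n + 2) / 2))\<^sup>2 / (Gamma ((real n + 3) / 2) * Gamma ((real n + 1) / 2))) / (2 * real n)"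
    unfolding mean_value_const_def Gamma_quotient_double_fact by simp
  moreover have "(real n + 2) / 2 = x + 1 / 2" "(real n + 3) / 2 = x + 1" "(real n + 1) / 2 = x"
    by (simp_all add: x_def add_divide_distrib)
  moreover have "(2 * real n + 2) / (2 * real n + 4) = x / (x + 1 / 2)"
    by (simp add: x_def field_simps)
  ultimately have "mean_value_const n
      = x / (x + 1 / 2) * ((Gamma (x + 1 / 2))\<^sup>2 / (Gamma (x + 1) * Gamma x)) / (2 * real n)"
    by (simp only:)
  then show ?thesis
    by (simp add: power2_eq_square mult_ac)
qed

section \<open>Symmetries of Lebesgue measure\<close>

text \<open>
  By Tonelli: for fixed horizontal part the map is a translation of the vertical coordinate. Left
  translations of the Heisenberg group have this form.
\<close>

lemma distr_lborel_shear:
  fixes h :: "'e::euclidean_space \<Rightarrow> real"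
  assumes [measurable]: "h \<in> borel_measurable borel"
  shows "distr lborel borel (\<lambda>z. (fst z + a, snd z + h (fst z))) = lborel"
proof (rule measure_eqI)
  fix A :: "('e \<times> real) set" assume "A \<in> sets (distr lborel borel (\<lambda>z. (fst z + a, snd z + h (fst z))))"
  then have [measurable]: "A \<in> sets borel" by simp
  have m: "(\<lambda>z. indicator A (fst z + a, snd z + h (fst z)) :: ennreal) \<in> borel_measurable borel"
    by simp
  have fubini: "(\<integral>\<^sup>+z. f z \<partial>lborel) = (\<integral>\<^sup>+x. \<integral>\<^sup>+y. f (x, y) \<partial>lborel \<partial>lborel)"
    if "f \<in> borel_measurable borel" for f :: "'e \<times> real \<Rightarrow> ennreal"
    using lborel.nn_integral_fst[of f "lborel :: 'e measure"] that by (simp add: lborel_prod)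
  have "emeasure (distr lborel borel (\<lambda>z. (fst z + a, snd z + h (fst z)))) A
      = (\<integral>\<^sup>+z. indicator A (fst z + a, snd z + h (fst z)) \<partial>lborel)"
    by (subst nn_integral_indicator[symmetric], simp, subst nn_integral_distr) auto
  also have "\<dots> = (\<integral>\<^sup>+x. \<integral>\<^sup>+y. indicator A (x + a, y + h x) \<partial>lborel \<partial>lborel)"
    by (subst fubini[OF m]) simp
  also have "\<dots> = (\<integral>\<^sup>+x. \<integral>\<^sup>+y. indicator A (x + a, y) \<partial>lborel \<partial>lborel)"
  proof (rule nn_integral_cong)
    fix x
    show "(\<integral>\<^sup>+y. indicator A (x + a, y + h x) \<partial>lborel) = (\<integral>\<^sup>+y. indicator A (x + a, y) \<partial>lborel)"
      using nn_integral_real_affine[of "\<lambda>y. indicator A (x + a, y)" 1 "h x"] by (simp add: add.commute)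
  qed
  also have "\<dots> = (\<integral>\<^sup>+x. \<integral>\<^sup>+y. indicator A (x, y) \<partial>lborel \<partial>lborel)"
    by (subst (2) lborel_distr_plus[of a, symmetric], subst nn_integral_distr) (auto simp: add.commute)
  also have "\<dots> = emeasure lborel A"
    by (subst fubini[symmetric]) auto
  finally show "emeasure (distr lborel borel (\<lambda>z. (fst z + a, snd z + h (fst z)))) A = emeasure lborel A" .
qed simp

lemma integral_shear:
  fixes f :: "'e::euclidean_space \<times> real \<Rightarrow> real"
  assumes "f \<in> borel_measurable borel" "h \<in> borel_measurable borel"
  shows "(\<integral>z. f (fst z + a, snd z + h (fst z)) \<partial>lborel) = (\<integral>z. f z \<partial>lborel)"
  using assms by (subst (2) distr_lborel_shear[OF assms(2), of a, symmetric], subst integral_distr) auto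

lemma integral_uminus_lborel:
  fixes f :: "'e::euclidean_space \<Rightarrow> real"
  assumes "f \<in> borel_measurable borel"
  shows "(\<integral>z. f (- z) \<partial>lborel) = (\<integral>z. f z \<partial>lborel)"
proof -
  have "distr lborel borel uminus = (lborel :: 'e measure)"
    by (subst lborel_affine[of "-1" 0]) (auto simp: density_1 one_ennreal_def[symmetric])
  then have "(\<integral>z. f z \<partial>lborel) = (\<integral>z. f z \<partial>distr lborel borel uminus)"
    by simp
  also have "\<dots> = (\<integral>z. f (- z) \<partial>lborel)"
    using assms by (subst integral_distr) auto
  finally show ?thesis by simp
qed

lemma integral_horizontal_map:
  fixes f :: "'e::euclidean_space \<times> real \<Rightarrow> real"
  assumes [measurable]: "f \<in> borel_measurable borel" "T \<in> borel \<rightarrow>\<^sub>M borel"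
    and T: "distr lborel borel T = lborel"
  shows "(\<integral>z. f (T (fst z), snd z) \<partial>lborel) = (\<integral>z. f z \<partial>lborel)"
proof -
  have "distr lborel lborel T = lborel"
    using T by (simp cong: distr_cong)
  moreover have "distr lborel lborel (\<lambda>y::real. y) = lborel"
    by (rule distr_id)
  moreover have "sigma_finite_measure (distr lborel lborel (\<lambda>y::real. y))"
    unfolding distr_id by (rule lborel.sigma_finite_measure_axioms)
  ultimately have "lborel \<Otimes>\<^sub>M lborel = distr (lborel \<Otimes>\<^sub>M lborel) (lborel \<Otimes>\<^sub>M lborel) (\<lambda>(x, y::real). (T x, y))"
    using pair_measure_distr[of T lborel lborel "\<lambda>y::real. y" lborel lborel] by simp
  then have "lborel = distr lborel lborel (\<lambda>(x, y::real). (T x, y))"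
    unfolding lborel_prod .
  then have "(\<integral>z. f z \<partial>lborel) = (\<integral>z. f z \<partial>distr lborel lborel (\<lambda>(x, y::real). (T x, y)))"
    by simp
  also have "\<dots> = (\<integral>z. f (T (fst z), snd z) \<partial>lborel)"
    by (subst integral_distr) (auto simp: case_prod_beta)
  finally show ?thesis by simp
qed

lemma integral_coordinate_flip:
  fixes f :: "'e::euclidean_space \<times> real \<Rightarrow> real"
  assumes f: "f \<in> borel_measurable borel" and b: "b \<in> Basis"
  shows "(\<integral>z. f (fst z - (2 * (fst z \<bullet> b)) *\<^sub>R b, snd z) \<partial>lborel) = (\<integral>z. f z \<partial>lborel)"
proof (rule integral_horizontal_map[OF f, where T = "\<lambda>x. x - (2 * (x \<bullet> b)) *\<^sub>R b"])
  let ?c = "\<lambda>i. if i = b then -1 else 1 :: real"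
  have "(\<Sum>i\<in>Basis. (?c i * (x \<bullet> i)) *\<^sub>R i) = x - (2 * (x \<bullet> b)) *\<^sub>R b" for x :: 'e
  proof (rule euclidean_eqI)
    fix i :: 'e assume "i \<in> Basis"
    then show "(\<Sum>i\<in>Basis. (?c i * (x \<bullet> i)) *\<^sub>R i) \<bullet> i = (x - (2 * (x \<bullet> b)) *\<^sub>R b) \<bullet> i"
      using b by (simp add: inner_diff_left inner_Basis)
  qed
  moreover have "(\<Prod>j\<in>Basis. \<bar>?c j\<bar>) = 1"
    by (intro prod.neutral) auto
  ultimately have "lborel = density (distr lborel borel (\<lambda>x::'e. x - (2 * (x \<bullet> b)) *\<^sub>R b)) (\<lambda>_. 1)"
    using lborel_affine_euclidean[of ?c 0] by simp
  then show "distr lborel borel (\<lambda>x::'e. x - (2 * (x \<bullet> b)) *\<^sub>R b) = lborel"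
    by (simp add: density_1)
qed simp

text \<open>
  For basis vectors \<open>a\<close> and \<open>b\<close> the reflection in the hyperplane orthogonal to \<open>a - b\<close> exchanges two
  coordinates, so it maps boxes to boxes of the same volume, and this characterizes Lebesgue measure.
\<close>

lemma integral_coordinate_swap:
  fixes f :: "'e::euclidean_space \<times> real \<Rightarrow> real"
  assumes f: "f \<in> borel_measurable borel" and ab: "a \<in> Basis" "b \<in> Basis" "a \<noteq> b"
  shows "(\<integral>z. f (fst z - (fst z \<bullet> (a - b)) *\<^sub>R (a - b), snd z) \<partial>lborel) = (\<integral>z. f z \<partial>lborel)"
proof -
  define T where "T = (\<lambda>x::'e. x - (x \<bullet> (a - b)) *\<^sub>R (a - b))"
  define \<pi> where "\<pi> i = (if i = a then b else if i = b then a else i)" for i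
  have T: "T x \<bullet> i = x \<bullet> \<pi> i" if "i \<in> Basis" for x i
    using that ab by (auto simp: T_def \<pi>_def inner_diff_left inner_diff_right inner_Basis)
  have \<pi>: "\<pi> i \<in> Basis \<longleftrightarrow> i \<in> Basis" "\<pi> (\<pi> i) = i" for i
    using ab by (auto simp: \<pi>_def)
  have bij: "bij_betw \<pi> Basis Basis"
    by (rule bij_betwI[where g = \<pi>]) (use \<pi> in auto)
  have meas: "T \<in> borel \<rightarrow>\<^sub>M borel"
    by (simp add: T_def)
  have distr: "distr lborel borel T = lborel"
  proof (rule lborel_eqI[symmetric])
    fix l u :: 'e assume le: "\<And>b. b \<in> Basis \<Longrightarrow> l \<bullet> b \<le> u \<bullet> b"
    have "T x \<in> box l u \<longleftrightarrow> (\<forall>i\<in>Basis. l \<bullet> i < x \<bullet> \<pi> i \<and> x \<bullet> \<pi> i < u \<bullet> i)" for x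
      by (auto simp: mem_box T)
    moreover have "x \<in> box (T l) (T u) \<longleftrightarrow> (\<forall>i\<in>Basis. l \<bullet> \<pi> i < x \<bullet> i \<and> x \<bullet> i < u \<bullet> \<pi> i)" for x
      by (auto simp: mem_box T)
    ultimately have "T -` box l u = box (T l) (T u)"
      using \<pi> by (intro set_eqI) (metis vimage_eq)
    then have "emeasure (distr lborel borel T) (box l u) = emeasure lborel (box (T l) (T u))"
      using meas by (subst emeasure_distr) auto
    also have "\<dots> = (\<Prod>i\<in>Basis. (T u - T l) \<bullet> i)"
      using le \<pi> by (intro emeasure_lborel_box) (simp add: T)
    also have "(\<Prod>i\<in>Basis. (T u - T l) \<bullet> i) = (\<Prod>i\<in>Basis. (u - l) \<bullet> \<pi> i)"
      using T by (intro prod.cong refl) (simp add: inner_diff_left)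
    also have "\<dots> = (\<Prod>i\<in>Basis. (u - l) \<bullet> i)"
      by (rule prod.reindex_bij_betw[OF bij])
    finally show "emeasure (distr lborel borel T) (box l u) = (\<Prod>i\<in>Basis. (u - l) \<bullet> i)" .
  qed simp
  show ?thesis
    using integral_horizontal_map[OF f meas distr] by (simp add: T_def)
qed

text \<open>
  Changing the sign of the coordinate along \<open>b\<close> negates the integrand.
\<close>

lemma integral_cross_moment:
  fixes w :: "real \<Rightarrow> real \<Rightarrow> real"
  assumes m: "(\<lambda>z. w (norm (fst z)) (snd z)) \<in> borel_measurable (borel :: ('e::euclidean_space \<times> real) measure)"
    and ab: "a \<in> Basis" "b \<in> Basis" "a \<noteq> b"
  shows "(\<integral>z. w (norm (fst z)) (snd z) * ((fst (z :: 'e \<times> real) \<bullet> a) * (fst z \<bullet> b)) \<partial>lborel) = 0"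
proof -
  let ?f = "\<lambda>z. w (norm (fst z)) (snd z) * ((fst (z :: 'e \<times> real) \<bullet> a) * (fst z \<bullet> b))"
  have f: "?f \<in> borel_measurable borel"
    using m by (intro borel_measurable_times) auto
  have "norm (x - (2 * (x \<bullet> b)) *\<^sub>R b) = norm x" for x :: 'e
    using ab by (simp add: norm_eq inner_diff_left inner_diff_right inner_commute)
  moreover have "(x - (2 * (x \<bullet> b)) *\<^sub>R b) \<bullet> a = x \<bullet> a" "(x - (2 * (x \<bullet> b)) *\<^sub>R b) \<bullet> b = - (x \<bullet> b)" for x :: 'e
    using ab by (simp_all add: inner_diff_left inner_Basis)
  ultimately have "(\<integral>z. - ?f z \<partial>lborel) = (\<integral>z. ?f z \<partial>lborel)"
    using integral_coordinate_flip[OF f ab(2)] by simp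
  then show ?thesis by simp
qed

lemma integral_square_moment_eq:
  fixes w :: "real \<Rightarrow> real \<Rightarrow> real"
  assumes m: "(\<lambda>z. w (norm (fst z)) (snd z)) \<in> borel_measurable (borel :: ('e::euclidean_space \<times> real) measure)"
    and ab: "a \<in> Basis" "b \<in> Basis"
  shows "(\<integral>z. w (norm (fst z)) (snd z) * (fst (z :: 'e \<times> real) \<bullet> a)\<^sup>2 \<partial>lborel)
       = (\<integral>z. w (norm (fst z)) (snd z) * (fst (z :: 'e \<times> real) \<bullet> b)\<^sup>2 \<partial>lborel)"
proof (cases "a = b")
  case False
  let ?f = "\<lambda>z. w (norm (fst z)) (snd z) * (fst (z :: 'e \<times> real) \<bullet> b)\<^sup>2"
  have f: "?f \<in> borel_measurable borel"
    using m by (intro borel_measurable_times) auto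
  have "(a - b) \<bullet> (a - b) = 2"
    using ab False by (simp add: inner_diff_left inner_diff_right inner_Basis)
  then have "norm (x - (x \<bullet> (a - b)) *\<^sub>R (a - b)) = norm x" for x :: 'e
    unfolding norm_eq
    by (simp add: inner_diff_left[of x] inner_diff_right[of _ x] inner_commute[of "a - b" x] right_diff_distrib
             del: inner_diff_left inner_diff_right)
  moreover have "(x - (x \<bullet> (a - b)) *\<^sub>R (a - b)) \<bullet> b = x \<bullet> a" for x :: 'e
    using ab False by (simp add: inner_diff_left inner_diff_right inner_Basis)
  ultimately show ?thesis
    using integral_coordinate_swap[OF f ab False] by simp
qed simp

text \<open>
  All coordinate directions contribute equally, and together they give the squared norm.
\<close>

lemma integral_square_moment:
  fixes w :: "real \<Rightarrow> real \<Rightarrow> real"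
  assumes m: "(\<lambda>z. w (norm (fst z)) (snd z)) \<in> borel_measurable (borel :: ('e::euclidean_space \<times> real) measure)"
    and int: "integrable lborel (\<lambda>z :: 'e \<times> real. w (norm (fst z)) (snd z) * (norm (fst z))\<^sup>2)"
    and b: "b \<in> Basis"
  shows "(\<integral>z. w (norm (fst z)) (snd z) * (fst (z :: 'e \<times> real) \<bullet> b)\<^sup>2 \<partial>lborel)
       = (\<integral>z. w (norm (fst z)) (snd z) * (norm (fst (z :: 'e \<times> real)))\<^sup>2 \<partial>lborel) / real DIM('e)"
proof -
  have int_a: "integrable lborel (\<lambda>z :: 'e \<times> real. w (norm (fst z)) (snd z) * (fst z \<bullet> a)\<^sup>2)" if "a \<in> Basis" for a
  proof (rule Bochner_Integration.integrable_bound[OF int])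
    show "(\<lambda>z :: 'e \<times> real. w (norm (fst z)) (snd z) * (fst z \<bullet> a)\<^sup>2) \<in> borel_measurable lborel"
      using m by (intro borel_measurable_times) auto
    have "(x \<bullet> a)\<^sup>2 \<le> (norm x)\<^sup>2" for x :: 'e
      using Basis_le_norm[OF that, of x] by (simp add: abs_le_square_iff[symmetric])
    then show "AE z in lborel. norm (w (norm (fst z)) (snd z) * (fst z \<bullet> a)\<^sup>2)
        \<le> norm (w (norm (fst z)) (snd z) * (norm (fst (z :: 'e \<times> real)))\<^sup>2)"
      by (intro AE_I2) (auto simp: abs_mult intro!: mult_left_mono)
  qed
  have "(\<integral>z. w (norm (fst z)) (snd z) * (norm (fst (z :: 'e \<times> real)))\<^sup>2 \<partial>lborel)
      = (\<integral>z. (\<Sum>a\<in>Basis. w (norm (fst z)) (snd z) * (fst (z :: 'e \<times> real) \<bullet> a)\<^sup>2) \<partial>lborel)"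
    unfolding sum_distrib_left[symmetric] power2_norm_eq_inner
    by (subst euclidean_inner) (simp add: power2_eq_square)
  also have "\<dots> = (\<Sum>a\<in>Basis. \<integral>z. w (norm (fst z)) (snd z) * (fst (z :: 'e \<times> real) \<bullet> a)\<^sup>2 \<partial>lborel)"
    using int_a by (intro Bochner_Integration.integral_sum) auto
  also have "\<dots> = (\<Sum>a\<in>(Basis :: 'e set). \<integral>z. w (norm (fst z)) (snd z) * (fst (z :: 'e \<times> real) \<bullet> b)\<^sup>2 \<partial>lborel)"
    using integral_square_moment_eq[OF m _ b] by (intro sum.cong) auto
  finally show ?thesis by (simp add: field_simps)
qed

section \<open>Taylor expansion\<close>

lemmas has_frechet_derivative = frechet_derivative_works[THEN iffD1]

text \<open>
  Restricting to a line reduces the Taylor estimates below to the mean value inequality in one variable.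
\<close>

lemma line_has_real_derivative:
  assumes "(f has_derivative f') (at (q + c *\<^sub>R v))"
  shows "((\<lambda>c. f (q + c *\<^sub>R v)) has_real_derivative f' v) (at c within A)"
proof -
  have "((\<lambda>c. q + c *\<^sub>R v) has_derivative (\<lambda>k. k *\<^sub>R v)) (at c within A)"
    by (auto intro!: derivative_eq_intros)
  then have "((\<lambda>c. f (q + c *\<^sub>R v)) has_derivative (\<lambda>k. f' (k *\<^sub>R v))) (at c within A)"
    using has_derivative_compose assms by blast
  moreover have "f' (k *\<^sub>R v) = f' v * k" for k
    using has_derivative_linear[OF assms] by (simp add: linear_scale)
  ultimately show ?thesis
    by (simp add: has_field_derivative_def)
qed

text \<open>
  The uniformity in the base point \<open>q\<close> is what permits a first-order expansion in the vertical and the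
  time variable after the point has already been moved horizontally.
\<close>

lemma uniform_first_order:
  fixes u :: "'a::real_normed_vector \<Rightarrow> real"
  assumes S: "open S" "p \<in> S" and u: "\<And>x. x \<in> S \<Longrightarrow> u differentiable (at x)"
    and cont: "isCont (\<lambda>x. frechet_derivative u (at x) v) p" and \<eta>: "\<eta> > 0"
  shows "\<exists>\<delta>>0. \<forall>q c. dist q p < \<delta> \<longrightarrow> \<bar>c\<bar> < \<delta> \<longrightarrow>
           \<bar>u (q + c *\<^sub>R v) - u q - c * frechet_derivative u (at p) v\<bar> \<le> \<eta> * \<bar>c\<bar>"
proof -
  obtain r1 where r1: "r1 > 0" "ball p r1 \<subseteq> S"
    using S open_contains_ball by blast
  obtain r2 where r2: "r2 > 0" "\<And>x. dist x p < r2 \<Longrightarrow>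
      dist (frechet_derivative u (at x) v) (frechet_derivative u (at p) v) < \<eta>"
    using cont \<eta> unfolding continuous_at_eps_delta by metis
  define \<delta> where "\<delta> = min r1 r2 / (1 + norm v)"
  have \<delta>: "\<delta> > 0" "\<delta> + \<delta> * norm v = min r1 r2"
  proof -
    have v: "1 + norm v > 0" by (simp add: add_pos_nonneg)
    then show "\<delta> > 0" using r1 r2 by (simp add: \<delta>_def)
    have "\<delta> * (1 + norm v) = min r1 r2" using v by (simp add: \<delta>_def)
    then show "\<delta> + \<delta> * norm v = min r1 r2" by (simp add: distrib_left)
  qed
  show ?thesis
  proof (intro exI[of _ \<delta>] conjI allI impI \<delta>(1))
    fix q c assume q: "dist q p < \<delta>" and c: "\<bar>c\<bar> < \<delta>"
    let ?d = "frechet_derivative u (at p) v"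
    let ?\<phi> = "\<lambda>\<tau>. u (q + \<tau> *\<^sub>R v) - \<tau> * ?d"
    have near: "dist (q + \<tau> *\<^sub>R v) p < min r1 r2" if "\<tau> \<in> {- \<bar>c\<bar>..\<bar>c\<bar>}" for \<tau>
    proof -
      have "dist (q + \<tau> *\<^sub>R v) p \<le> dist q p + \<bar>\<tau>\<bar> * norm v"
        using norm_triangle_ineq[of "q - p" "\<tau> *\<^sub>R v"] by (simp add: dist_norm algebra_simps)
      also have "\<bar>\<tau>\<bar> * norm v \<le> \<delta> * norm v"
        using that c by (intro mult_right_mono) auto
      finally show ?thesis using q \<delta>(2) by linarith
    qed
    have "norm (?\<phi> c - ?\<phi> 0) \<le> \<eta> * norm (c - 0)"
    proof (rule field_differentiable_bound[where S = "{- \<bar>c\<bar>..\<bar>c\<bar>}"])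
      fix \<tau> assume \<tau>: "\<tau> \<in> {- \<bar>c\<bar>..\<bar>c\<bar>}"
      then have "q + \<tau> *\<^sub>R v \<in> S"
        using near r1 by (auto simp: dist_commute)
      then have "(u has_derivative frechet_derivative u (at (q + \<tau> *\<^sub>R v))) (at (q + \<tau> *\<^sub>R v))"
        by (intro has_frechet_derivative u)
      from line_has_real_derivative[OF this]
      show "(?\<phi> has_field_derivative frechet_derivative u (at (q + \<tau> *\<^sub>R v)) v - ?d)
          (at \<tau> within {- \<bar>c\<bar>..\<bar>c\<bar>})"
        by (auto intro!: derivative_eq_intros)
      show "norm (frechet_derivative u (at (q + \<tau> *\<^sub>R v)) v - ?d) \<le> \<eta>"
        using r2(2)[of "q + \<tau> *\<^sub>R v"] near[OF \<tau>] by (simp add: dist_norm)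
    qed auto
    then show "\<bar>u (q + c *\<^sub>R v) - u q - c * ?d\<bar> \<le> \<eta> * \<bar>c\<bar>"
      by (simp add: algebra_simps)
  qed
qed

text \<open>
  The Hessian, curried so that the argument \<open>w\<close> is the direction of the inner derivative; this matches the
  directional derivatives in which smoothness is expressed.
\<close>

definition second_derivative :: "('a::real_normed_vector \<Rightarrow> real) \<Rightarrow> 'a \<Rightarrow> 'a \<Rightarrow> 'a \<Rightarrow> real" where
  "second_derivative u p w = frechet_derivative (\<lambda>x. frechet_derivative u (at x) w) (at p)"

definition twice_differentiable_at :: "('a::real_normed_vector \<Rightarrow> real) \<Rightarrow> 'a \<Rightarrow> bool" where
  "twice_differentiable_at u p \<longleftrightarrow> (\<exists>S. open S \<and> p \<in> S \<and> (\<forall>x\<in>S. u differentiable (at x)))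
     \<and> (\<forall>w. (\<lambda>x. frechet_derivative u (at x) w) differentiable (at p))"

lemma second_derivative_linear_right:
  "twice_differentiable_at u p \<Longrightarrow> linear (second_derivative u p w)"
  unfolding second_derivative_def twice_differentiable_at_def by (intro linear_frechet_derivative) blast

lemma second_derivative_works:
  "twice_differentiable_at u p \<Longrightarrow>
     ((\<lambda>x. frechet_derivative u (at x) w) has_derivative second_derivative u p w) (at p)"
  unfolding second_derivative_def twice_differentiable_at_def by (intro has_frechet_derivative) blast

lemma second_derivative_linear_left:
  assumes u: "twice_differentiable_at u p"
  shows "linear (\<lambda>w. second_derivative u p w k)"
proof (rule linearI)
  obtain S where S: "open S" "p \<in> S" "\<And>x. x \<in> S \<Longrightarrow> linear (frechet_derivative u (at x))"
    using u linear_frechet_derivative unfolding twice_differentiable_at_def by blast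
  note works = second_derivative_works[OF u]
  fix a b :: 'a and c :: real
  have "((\<lambda>x. frechet_derivative u (at x) (a + b)) has_derivative
      (\<lambda>k. second_derivative u p a k + second_derivative u p b k)) (at p)"
    by (rule has_derivative_transform_within_open[OF has_derivative_add[OF works[of a] works[of b]] S(1,2)])
       (simp add: S(3) linear_add)
  then show "second_derivative u p (a + b) k = second_derivative u p a k + second_derivative u p b k"
    using has_derivative_unique works by metis
  have "((\<lambda>x. frechet_derivative u (at x) (c *\<^sub>R a)) has_derivative
      (\<lambda>k. c *\<^sub>R second_derivative u p a k)) (at p)"
    by (rule has_derivative_transform_within_open[OF has_derivative_scaleR_right[OF works[of a]] S(1,2)])
       (simp add: S(3) linear_scale)
  then show "second_derivative u p (c *\<^sub>R a) k = c *\<^sub>R second_derivative u p a k"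
    using has_derivative_unique works by metis
qed

lemma linear_basis_sum:
  fixes f :: "'a::euclidean_space \<Rightarrow> real"
  assumes "linear f"
  shows "f h = (\<Sum>b\<in>Basis. (h \<bullet> b) * f b)"
proof -
  have "f h = f (\<Sum>b\<in>Basis. (h \<bullet> b) *\<^sub>R b)"
    by (simp add: euclidean_representation)
  also have "\<dots> = (\<Sum>b\<in>Basis. (h \<bullet> b) * f b)"
    using assms by (simp add: linear_sum linear_scale)
  finally show ?thesis .
qed

text \<open>
  Along the segment from \<open>p\<close> to \<open>p + h\<close> the remainder has derivative \<open>D u (p + \<tau> h) h - D u (p) h - \<tau> D\<^sup>2 u (h, h)\<close>.
  Differentiability of the gradient at the single point \<open>p\<close> bounds this by \<open>\<eta> \<bar>h\<bar>\<^sup>2\<close>; linearity in the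
  direction reduces uniformity in \<open>h\<close> to the finitely many basis directions.
\<close>

lemma taylor_peano_second_order:
  fixes u :: "'a::euclidean_space \<Rightarrow> real"
  assumes u: "twice_differentiable_at u p" and \<eta>: "\<eta> > 0"
  shows "\<exists>\<delta>>0. \<forall>h. norm h < \<delta> \<longrightarrow>
    \<bar>u (p + h) - u p - frechet_derivative u (at p) h - second_derivative u p h h / 2\<bar> \<le> \<eta> * (norm h)\<^sup>2"
proof -
  let ?D = "\<lambda>x. frechet_derivative u (at x)"
  let ?B = "second_derivative u p"
  obtain S where S: "open S" "p \<in> S" "\<And>x. x \<in> S \<Longrightarrow> u differentiable (at x)"
    using u unfolding twice_differentiable_at_def by blast
  obtain r where r: "r > 0" "ball p r \<subseteq> S"
    using S open_contains_ball by blast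
  define \<eta>' where "\<eta>' = \<eta> / real DIM('a)"
  have \<eta>': "\<eta>' > 0" using \<eta> by (simp add: \<eta>'_def)
  have "\<exists>d>0. \<forall>x. norm (x - p) < d \<longrightarrow> \<bar>?D x b - ?D p b - ?B b (x - p)\<bar> \<le> \<eta>' * norm (x - p)" for b
    using second_derivative_works[OF u, of b] \<eta>' unfolding has_derivative_at_alt by auto
  then obtain d where d: "\<And>b. d b > 0"
      "\<And>b x. norm (x - p) < d b \<Longrightarrow> \<bar>?D x b - ?D p b - ?B b (x - p)\<bar> \<le> \<eta>' * norm (x - p)"
    by metis
  define \<delta> where "\<delta> = Min (insert r (d ` Basis))"
  have \<delta>: "\<delta> > 0" "\<delta> \<le> r" "\<And>b. b \<in> Basis \<Longrightarrow> \<delta> \<le> d b"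
    using d(1) r(1) unfolding \<delta>_def by (simp, (intro Min_le; simp)+)
  have grad: "\<bar>?D (p + k) h - ?D p h - ?B h k\<bar> \<le> \<eta> * norm h * norm k" if k: "norm k < \<delta>" for h k
  proof -
    have pk: "p + k \<in> S"
      using k \<delta>(2) r(2) by (auto simp: dist_norm subset_iff)
    have "?D (p + k) h - ?D p h - ?B h k
        = (\<Sum>b\<in>Basis. (h \<bullet> b) * ?D (p + k) b) - (\<Sum>b\<in>Basis. (h \<bullet> b) * ?D p b) - (\<Sum>b\<in>Basis. (h \<bullet> b) * ?B b k)"
      using linear_basis_sum[OF linear_frechet_derivative[OF S(3)[OF pk]], of h]
        linear_basis_sum[OF linear_frechet_derivative[OF S(3)[OF S(2)]], of h]
        linear_basis_sum[OF second_derivative_linear_left[OF u], of h k]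
      by linarith
    also have "\<dots> = (\<Sum>b\<in>Basis. (h \<bullet> b) * (?D (p + k) b - ?D p b - ?B b k))"
      by (simp add: sum_subtractf right_diff_distrib)
    also have "\<bar>\<dots>\<bar> \<le> (\<Sum>b\<in>(Basis :: 'a set). norm h * (\<eta>' * norm k))"
    proof (rule order_trans[OF sum_abs sum_mono])
      fix b :: 'a assume b: "b \<in> Basis"
      show "\<bar>(h \<bullet> b) * (?D (p + k) b - ?D p b - ?B b k)\<bar> \<le> norm h * (\<eta>' * norm k)"
        unfolding abs_mult using d(2)[of "p + k" b] k \<delta>(3)[OF b] Basis_le_norm[OF b, of h]
        by (intro mult_mono) auto
    qed
    also have "\<dots> = \<eta> * norm h * norm k"
      by (simp add: \<eta>'_def)
    finally show ?thesis .
  qed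
  show ?thesis
  proof (intro exI[of _ \<delta>] conjI allI impI \<delta>(1))
    fix h :: 'a assume h: "norm h < \<delta>"
    let ?\<phi> = "\<lambda>\<tau>. u (p + \<tau> *\<^sub>R h) - \<tau> * ?D p h - \<tau>\<^sup>2 / 2 * ?B h h"
    have small: "norm (\<tau> *\<^sub>R h) \<le> norm h" if "\<tau> \<in> {0..1}" for \<tau>
      using that by (auto intro: mult_left_le_one_le)
    have "norm (?\<phi> 1 - ?\<phi> 0) \<le> (\<eta> * (norm h)\<^sup>2) * norm (1 - 0 :: real)"
    proof (rule field_differentiable_bound[where S = "{0..1}"])
      fix \<tau> :: real assume \<tau>: "\<tau> \<in> {0..1}"
      have "p + \<tau> *\<^sub>R h \<in> S"
        using small[OF \<tau>] h \<delta>(2) r(2) by (auto simp: dist_norm subset_iff)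
      then have "(u has_derivative ?D (p + \<tau> *\<^sub>R h)) (at (p + \<tau> *\<^sub>R h))"
        by (intro has_frechet_derivative S)
      from line_has_real_derivative[OF this]
      show "(?\<phi> has_field_derivative ?D (p + \<tau> *\<^sub>R h) h - ?D p h - \<tau> * ?B h h) (at \<tau> within {0..1})"
        by (auto intro!: derivative_eq_intros)
      have "\<tau> * ?B h h = ?B h (\<tau> *\<^sub>R h)"
        using second_derivative_linear_right[OF u] by (simp add: linear_scale)
      then have "norm (?D (p + \<tau> *\<^sub>R h) h - ?D p h - \<tau> * ?B h h) \<le> \<eta> * norm h * norm (\<tau> *\<^sub>R h)"
        using grad[of "\<tau> *\<^sub>R h" h] small[OF \<tau>] h by simp
      also have "\<dots> \<le> \<eta> * norm h * norm h"
        using small[OF \<tau>] \<eta> by (intro mult_left_mono) auto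
      finally show "norm (?D (p + \<tau> *\<^sub>R h) h - ?D p h - \<tau> * ?B h h) \<le> \<eta> * (norm h)\<^sup>2"
        by (simp add: power2_eq_square mult.assoc)
    qed auto
    then show "\<bar>u (p + h) - u p - ?D p h - ?B h h / 2\<bar> \<le> \<eta> * (norm h)\<^sup>2"
      by simp
  qed
qed

text \<open>
  The increment is split into three moves: \<open>h\<close> of size \<open>\<epsilon>\<close>, treated to second order, and then \<open>v\<close> and
  \<open>w\<close> with coefficients of size \<open>\<epsilon>\<^sup>2\<close>, for which first order suffices.
\<close>

lemma parabolic_taylor:
  fixes u :: "'a::euclidean_space \<Rightarrow> real"
  assumes u: "twice_differentiable_at u p" and \<eta>: "\<eta> > 0" and K: "K \<ge> 0"
  shows "\<exists>\<delta>>0. \<forall>\<epsilon> h a b. 0 < \<epsilon> \<longrightarrow> \<epsilon> < \<delta> \<longrightarrow> norm h \<le> K * \<epsilon> \<longrightarrow> \<bar>a\<bar> \<le> \<epsilon>\<^sup>2 \<longrightarrow> \<bar>b\<bar> \<le> \<epsilon>\<^sup>2 \<longrightarrow>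
    \<bar>u (p + h + a *\<^sub>R v + b *\<^sub>R w) - (u p + frechet_derivative u (at p) h + second_derivative u p h h / 2
        + a * frechet_derivative u (at p) v + b * frechet_derivative u (at p) w)\<bar> \<le> \<eta> * \<epsilon>\<^sup>2"
proof -
  let ?D = "frechet_derivative u (at p)"
  obtain S where S: "open S" "p \<in> S" "\<And>x. x \<in> S \<Longrightarrow> u differentiable (at x)"
    using u unfolding twice_differentiable_at_def by blast
  have cont: "isCont (\<lambda>x. frechet_derivative u (at x) v) p" for v
    using second_derivative_works[OF u] has_derivative_continuous by blast
  \<comment> \<open>Both first-order steps cost one share of the error, the second-order step \<open>K\<^sup>2\<close> shares.\<close>
  define \<eta>' where "\<eta>' = \<eta> / (2 + K\<^sup>2)"
  have \<eta>': "\<eta>' > 0" "\<eta>' * K\<^sup>2 + \<eta>' + \<eta>' = \<eta>"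
    using \<eta> by (auto simp: \<eta>'_def add_pos_nonneg divide_simps distrib_left[symmetric] add_nonneg_eq_0_iff) (auto simp: algebra_simps)
  obtain d1 where d1: "d1 > 0" "\<And>h. norm h < d1 \<Longrightarrow>
      \<bar>u (p + h) - u p - ?D h - second_derivative u p h h / 2\<bar> \<le> \<eta>' * (norm h)\<^sup>2"
    using taylor_peano_second_order[OF u \<eta>'(1)] by blast
  obtain d2 where d2: "d2 > 0" "\<And>q c. dist q p < d2 \<Longrightarrow> \<bar>c\<bar> < d2 \<Longrightarrow>
      \<bar>u (q + c *\<^sub>R v) - u q - c * ?D v\<bar> \<le> \<eta>' * \<bar>c\<bar>"
    using uniform_first_order[OF S cont \<eta>'(1)] by blast
  obtain d3 where d3: "d3 > 0" "\<And>q c. dist q p < d3 \<Longrightarrow> \<bar>c\<bar> < d3 \<Longrightarrow>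
      \<bar>u (q + c *\<^sub>R w) - u q - c * ?D w\<bar> \<le> \<eta>' * \<bar>c\<bar>"
    using uniform_first_order[OF S cont \<eta>'(1)] by blast
  define m where "m = min d1 (min d2 d3)"
  have m: "m > 0" using d1 d2 d3 by (simp add: m_def)
  define \<delta> where "\<delta> = min 1 (m / (K + norm v + 1))"
  have N: "K + norm v + 1 > 0" using K by (simp add: add_nonneg_pos)
  have \<delta>: "\<delta> > 0" "\<delta> \<le> 1" "\<delta> * (K + norm v + 1) \<le> m"
  proof -
    show "\<delta> > 0" "\<delta> \<le> 1" using m N by (auto simp: \<delta>_def)
    have "\<delta> \<le> m / (K + norm v + 1)" by (simp add: \<delta>_def)
    then show "\<delta> * (K + norm v + 1) \<le> m" using N by (simp add: pos_le_divide_eq)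
  qed
  show ?thesis
  proof (intro exI[of _ \<delta>] conjI allI impI \<delta>(1))
    fix \<epsilon> a b :: real and h :: 'a
    assume e: "0 < \<epsilon>" "\<epsilon> < \<delta>" and h: "norm h \<le> K * \<epsilon>" and a: "\<bar>a\<bar> \<le> \<epsilon>\<^sup>2" and b: "\<bar>b\<bar> \<le> \<epsilon>\<^sup>2"
    have "\<epsilon>\<^sup>2 \<le> \<epsilon>"
      using e \<delta>(2) by (simp add: power2_eq_square mult_left_le)
    have "\<epsilon> * (K + norm v + 1) < m"
      using e N \<delta>(3) by (smt (verit) mult_strict_right_mono)
    then have le: "K * \<epsilon> + \<epsilon> * norm v + \<epsilon> < m"
      by (simp add: algebra_simps)
    have nn: "K * \<epsilon> \<ge> 0" "\<epsilon> * norm v \<ge> 0" using e K by auto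
    have av: "norm (a *\<^sub>R v) \<le> \<epsilon> * norm v"
      using a \<open>\<epsilon>\<^sup>2 \<le> \<epsilon>\<close> by (auto intro!: mult_right_mono)
    have hav: "norm (h + a *\<^sub>R v) < m"
      using norm_triangle_ineq[of h "a *\<^sub>R v"] av h le nn e by linarith
    have hm: "norm h < m" "\<bar>a\<bar> < m" "\<bar>b\<bar> < m"
      using h le nn e a b \<open>\<epsilon>\<^sup>2 \<le> \<epsilon>\<close> by linarith+
    have "\<bar>u (p + h) - u p - ?D h - second_derivative u p h h / 2\<bar> \<le> \<eta>' * (norm h)\<^sup>2"
      using hm by (intro d1(2)) (simp add: m_def)
    also have "(norm h)\<^sup>2 \<le> K\<^sup>2 * \<epsilon>\<^sup>2"
      using power_mono[OF h, of 2] by (simp add: power_mult_distrib)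
    finally have 1: "\<bar>u (p + h) - u p - ?D h - second_derivative u p h h / 2\<bar> \<le> \<eta>' * K\<^sup>2 * \<epsilon>\<^sup>2"
      using \<eta>' by (simp add: mult.assoc)
    have "\<bar>u (p + h + a *\<^sub>R v) - u (p + h) - a * ?D v\<bar> \<le> \<eta>' * \<bar>a\<bar>"
      using hm by (intro d2(2)) (auto simp: m_def dist_norm)
    also have "\<dots> \<le> \<eta>' * \<epsilon>\<^sup>2"
      using a \<eta>' by simp
    finally have 2: "\<bar>u (p + h + a *\<^sub>R v) - u (p + h) - a * ?D v\<bar> \<le> \<eta>' * \<epsilon>\<^sup>2" .
    have "\<bar>u (p + h + a *\<^sub>R v + b *\<^sub>R w) - u (p + h + a *\<^sub>R v) - b * ?D w\<bar> \<le> \<eta>' * \<bar>b\<bar>"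
      using hm hav by (intro d3(2)) (auto simp: m_def dist_norm add.assoc)
    also have "\<dots> \<le> \<eta>' * \<epsilon>\<^sup>2"
      using b \<eta>' by simp
    finally have 3: "\<bar>u (p + h + a *\<^sub>R v + b *\<^sub>R w) - u (p + h + a *\<^sub>R v) - b * ?D w\<bar> \<le> \<eta>' * \<epsilon>\<^sup>2" .
    have "\<eta> * \<epsilon>\<^sup>2 = \<eta>' * K\<^sup>2 * \<epsilon>\<^sup>2 + \<eta>' * \<epsilon>\<^sup>2 + \<eta>' * \<epsilon>\<^sup>2"
      unfolding \<eta>'(2)[symmetric] by (simp add: algebra_simps)
    then show "\<bar>u (p + h + a *\<^sub>R v + b *\<^sub>R w) - (u p + ?D h + second_derivative u p h h / 2
        + a * ?D v + b * ?D w)\<bar> \<le> \<eta> * \<epsilon>\<^sup>2"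
      using 1 2 3 by linarith
  qed
qed

section \<open>The sub-Laplacian as a trace\<close>

lemma pderiv_along_eq:
  "f differentiable (at x) \<Longrightarrow> pderiv_along v f x = frechet_derivative f (at x) v"
  unfolding pderiv_along_def
  using line_has_real_derivative[where f = f and f' = "frechet_derivative f (at x)" and q = x and c = 0 and v = v and A = UNIV]
  by (intro DERIV_imp_deriv) (simp add: has_frechet_derivative)

text \<open>
  A first-order operator \<open>e + c z\<close> whose coefficient \<open>c\<close> is constant in the directions \<open>e\<close> and \<open>z\<close>: no
  derivative ever falls on the coefficient, so applying it twice at \<open>x\<close> gives the second derivative along
  the vector frozen at \<open>x\<close>.
\<close>

lemma pderiv_along_twice:
  fixes f :: "'a::real_normed_vector \<Rightarrow> real"
  assumes f: "twice_differentiable_at f x"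
    and c: "\<And>h. c (x + h *\<^sub>R e) = c x" "\<And>h. c (x + h *\<^sub>R z) = c x"
  defines "P \<equiv> \<lambda>g y. pderiv_along e g y + c y * pderiv_along z g y"
  shows "P (P f) x = second_derivative f x (e + c x *\<^sub>R z) (e + c x *\<^sub>R z)"
proof -
  let ?w = "e + c x *\<^sub>R z"
  obtain S where S: "open S" "x \<in> S" "\<And>y. y \<in> S \<Longrightarrow> f differentiable (at y)"
    using f unfolding twice_differentiable_at_def by blast
  have along: "pderiv_along v (P f) x = second_derivative f x ?w v"
    if v: "\<And>h. c (x + h *\<^sub>R v) = c x" for v
  proof -
    have "\<forall>\<^sub>F h in nhds 0. x + h *\<^sub>R v \<in> S"
    proof -
      have "((\<lambda>h. x + h *\<^sub>R v) \<longlongrightarrow> x + 0 *\<^sub>R v) (nhds (0::real))"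
        by (intro tendsto_intros filterlim_ident)
      then show ?thesis
        using S by (auto dest: topological_tendstoD)
    qed
    then have ev: "\<forall>\<^sub>F h in nhds 0. P f (x + h *\<^sub>R v) = frechet_derivative f (at (x + h *\<^sub>R v)) ?w"
    proof eventually_elim
      case (elim h)
      then show ?case
        using S(3)[OF elim] by (simp add: P_def pderiv_along_eq v linear_add linear_scale linear_frechet_derivative)
    qed
    have "((\<lambda>h. frechet_derivative f (at (x + h *\<^sub>R v)) ?w) has_real_derivative second_derivative f x ?w v) (at 0)"
      using line_has_real_derivative[where f = "\<lambda>y. frechet_derivative f (at y) ?w" and q = x and c = 0 and v = v and A = UNIV]
        second_derivative_works[OF f] by simp
    then have "deriv (\<lambda>h. frechet_derivative f (at (x + h *\<^sub>R v)) ?w) 0 = second_derivative f x ?w v"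
      by (rule DERIV_imp_deriv)
    then show ?thesis
      unfolding pderiv_along_def using deriv_cong_ev[OF ev refl] by simp
  qed
  have "P (P f) x = pderiv_along e (P f) x + c x * pderiv_along z (P f) x"
    by (simp only: P_def)
  then show ?thesis
    using along[OF c(1)] along[OF c(2)] second_derivative_linear_right[OF f, of ?w]
    by (simp add: linear_add linear_scale)
qed

lemma section_has_derivative:
  assumes "(u has_derivative u') (at (t, y))"
  shows "((\<lambda>y. u (t, y)) has_derivative (\<lambda>k. u' (0, k))) (at y)"
proof -
  have "(Pair t has_derivative Pair 0) (at y)"
    by (auto intro!: derivative_eq_intros)
  from has_derivative_compose[OF this, of u u'] assms show ?thesis by simp
qed

lemma section_frechet_derivative:
  assumes "u differentiable (at (t, y))"
  shows "(\<lambda>y. u (t, y)) differentiable (at y)"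
    "frechet_derivative (\<lambda>y. u (t, y)) (at y) = (\<lambda>k. frechet_derivative u (at (t, y)) (0, k))"
proof -
  have d: "((\<lambda>y. u (t, y)) has_derivative (\<lambda>k. frechet_derivative u (at (t, y)) (0, k))) (at y)"
    using assms by (intro section_has_derivative has_frechet_derivative)
  then show "(\<lambda>y. u (t, y)) differentiable (at y)"
    by (rule differentiableI)
  show "frechet_derivative (\<lambda>y. u (t, y)) (at y) = (\<lambda>k. frechet_derivative u (at (t, y)) (0, k))"
    using d by (rule frechet_derivative_at[symmetric])
qed

lemma section_twice_differentiable:
  assumes u: "twice_differentiable_at u (t, x)"
  shows "twice_differentiable_at (\<lambda>y. u (t, y)) x"
    "second_derivative (\<lambda>y. u (t, y)) x w k = second_derivative u (t, x) (0, w) (0, k)"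
proof -
  obtain S where S: "open S" "(t, x) \<in> S" "\<And>q. q \<in> S \<Longrightarrow> u differentiable (at q)"
    using u unfolding twice_differentiable_at_def by blast
  define R where "R = Pair t -` S"
  have R: "open R" "x \<in> R"
    unfolding R_def using S by (auto intro!: open_vimage continuous_intros)
  have diff: "u differentiable (at (t, y))" if "y \<in> R" for y
    using that S by (simp add: R_def)
  have d: "((\<lambda>y. frechet_derivative (\<lambda>y. u (t, y)) (at y) w) has_derivative
      (\<lambda>k. second_derivative u (t, x) (0, w) (0, k))) (at x)" for w
    by (rule has_derivative_transform_within_open[OF section_has_derivative[OF second_derivative_works[OF u, of "(0, w)"]] R])
       (simp add: section_frechet_derivative(2) diff)
  show "twice_differentiable_at (\<lambda>y. u (t, y)) x"
    unfolding twice_differentiable_at_def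
    using R section_frechet_derivative(1)[OF diff] d differentiableI by blast
  show "second_derivative (\<lambda>y. u (t, y)) x w k = second_derivative u (t, x) (0, w) (0, k)"
    unfolding second_derivative_def[of "\<lambda>y. u (t, y)"] using frechet_derivative_at[OF d] by metis
qed

lemma smooth_imp_twice_differentiable:
  assumes "smooth_on u S" "open S" "p \<in> S"
  shows "twice_differentiable_at u p"
proof -
  have "Ck_on (Suc (Suc 0)) u S"
    using assms(1) by (simp only: smooth_on_def)
  then show ?thesis
    using assms(2,3) unfolding twice_differentiable_at_def by auto
qed

text \<open>
  The differential at the origin of left translation by \<open>x\<close>, restricted to horizontal vectors.
\<close>

definition horizontal_lift :: "'n::finite heisenberg \<Rightarrow> (real ^ 'n) \<times> (real ^ 'n) \<Rightarrow> 'n heisenberg" where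
  "horizontal_lift x h = (h, 2 * (\<Sum>i\<in>UNIV. fst h $ i * snd (fst x) $ i - fst (fst x) $ i * snd h $ i))"

lemma linear_horizontal_lift: "linear (horizontal_lift x)"
  by (rule linearI)
     (simp_all add: horizontal_lift_def algebra_simps sum.distrib sum_subtractf sum_distrib_left)

lemma heis_mult_horizontal_lift: "x \<circ>\<^sub>H z = x + horizontal_lift x (fst z) + snd z *\<^sub>R (0, 1)"
  by (simp add: heis_mult_def horizontal_lift_def prod_eq_iff)

text \<open>
  These are the values at \<open>x\<close> of the fields \<open>X\<^sub>i\<close> and \<open>X\<^sub>n\<^sub>+\<^sub>i\<close>.
\<close>

lemma horizontal_lift_axis:
  "horizontal_lift x (axis i 1, 0) = ((axis i 1, 0), 0) + (2 * snd (fst x) $ i) *\<^sub>R ((0, 0), 1)"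
  "horizontal_lift x (0, axis i 1) = ((0, axis i 1), 0) + (- 2 * fst (fst x) $ i) *\<^sub>R ((0, 0), 1)"
proof -
  have "(\<Sum>j\<in>UNIV. axis i 1 $ j * g j) = g i" "(\<Sum>j\<in>UNIV. g j * axis i 1 $ j) = g i" for g :: "'a \<Rightarrow> real"
    by (simp_all add: axis_def if_distrib[where f = "\<lambda>c. c * _"] if_distrib[where f = "\<lambda>c. _ * c"] cong: if_cong)
  then show "horizontal_lift x (axis i 1, 0) = ((axis i 1, 0), 0) + (2 * snd (fst x) $ i) *\<^sub>R ((0, 0), 1)"
    "horizontal_lift x (0, axis i 1) = ((0, axis i 1), 0) + (- 2 * fst (fst x) $ i) *\<^sub>R ((0, 0), 1)"
    by (simp_all add: horizontal_lift_def sum_negf)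
qed

lemma sum_Basis_cart_pair:
  fixes g :: "(real ^ 'n) \<times> (real ^ 'n) \<Rightarrow> real"
  shows "(\<Sum>h\<in>Basis. g h) = (\<Sum>i\<in>(UNIV :: 'n::finite set). g (axis i 1, 0)) + (\<Sum>i\<in>UNIV. g (0, axis i 1))"
proof -
  have B: "(Basis :: (real ^ 'n) set) = (\<lambda>i. axis i 1) ` UNIV"
    by (auto simp: Basis_vec_def)
  have inj: "inj (\<lambda>i. axis i (1::real) :: real ^ 'n)"
    by (auto simp: inj_on_def axis_eq_axis)
  have "(\<Sum>h\<in>Basis. g h) = (\<Sum>h\<in>(\<lambda>b. (b, 0)) ` Basis. g h) + (\<Sum>h\<in>(\<lambda>b. (0, b)) ` Basis. g h)"
    unfolding Basis_prod_def by (rule sum.union_disjoint) (auto simp: nonzero_Basis)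
  also have "\<dots> = (\<Sum>b\<in>Basis. g (b, 0)) + (\<Sum>b\<in>Basis. g (0, b))"
    by (subst (1 2) sum.reindex) (auto simp: inj_on_def)
  also have "\<dots> = (\<Sum>i\<in>UNIV. g (axis i 1, 0)) + (\<Sum>i\<in>UNIV. g (0, axis i 1))"
    unfolding B by (subst (1 2) sum.reindex[OF inj]) simp
  finally show ?thesis .
qed

lemma sub_laplacian_eq_trace:
  fixes f :: "'n::finite heisenberg \<Rightarrow> real"
  assumes f: "twice_differentiable_at f x"
  shows "sub_laplacian f x = (\<Sum>h\<in>Basis. second_derivative f x (horizontal_lift x h) (horizontal_lift x h))"
proof -
  have "heis_X i (heis_X i f) x = second_derivative f x (horizontal_lift x (axis i 1, 0)) (horizontal_lift x (axis i 1, 0))" for i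
    unfolding horizontal_lift_axis heis_X_def[abs_def]
    by (rule pderiv_along_twice[OF f, where c = "\<lambda>y. 2 * snd (fst y) $ i"]) simp_all
  moreover have "heis_Y i (heis_Y i f) x = second_derivative f x (horizontal_lift x (0, axis i 1)) (horizontal_lift x (0, axis i 1))" for i
    unfolding horizontal_lift_axis heis_Y_def[abs_def]
    using pderiv_along_twice[OF f, where c = "\<lambda>y. - 2 * fst (fst y) $ i" and e = "((0, axis i 1), 0)" and z = "((0, 0), 1)"]
    by simp
  ultimately show ?thesis
    unfolding sub_laplacian_def sum_Basis_cart_pair by simp
qed

section \<open>The weight on a ball\<close>

text \<open>
  Ball and density are merged into one function, so that all averages become integrals over the whole space.
\<close>

definition ball_weight :: "real \<Rightarrow> 'n::finite heisenberg \<Rightarrow> real" where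
  "ball_weight r z = indicator (heis_ball 0 r) z * heis_psi z"

lemma heis_rho_gauge4: "heis_rho z = root 4 (gauge4 z)"
  by (simp add: heis_rho_def gauge4_def)

lemma heis_rho_less_iff: "r > 0 \<Longrightarrow> heis_rho z < r \<longleftrightarrow> gauge4 z < r ^ 4"
  using real_root_less_iff[of 4 "gauge4 z" "r ^ 4"] by (simp add: heis_rho_gauge4 real_root_power_cancel)

lemma mem_heis_ball: "y \<in> heis_ball x r \<longleftrightarrow> heis_inv x \<circ>\<^sub>H y \<in> heis_ball 0 r"
  by (simp add: heis_ball_def heis_inv_def[of 0])

lemma mem_heis_ball_0: "r > 0 \<Longrightarrow> z \<in> heis_ball 0 r \<longleftrightarrow> gauge4 z < r ^ 4"
  by (simp add: heis_ball_def heis_inv_def heis_rho_less_iff)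

lemma heis_rho_square: "(heis_rho z)\<^sup>2 = sqrt (gauge4 z)"
proof -
  have "((heis_rho z)\<^sup>2)\<^sup>2 = gauge4 z"
    using real_root_pow_pos2[of 4 "gauge4 z"] by (simp add: heis_rho_gauge4 gauge4_nonneg power_mult[symmetric])
  then show ?thesis
    by (metis real_sqrt_unique zero_le_power2)
qed

lemma ball_weight_gauge4:
  "r > 0 \<Longrightarrow> ball_weight r z = (norm (fst z))\<^sup>2 / sqrt (gauge4 z) * indicator {..<r ^ 4} (gauge4 z)"
  by (auto simp: ball_weight_def mem_heis_ball_0 heis_psi_def heis_rho_square split: split_indicator)

lemma ball_weight_nonneg: "0 \<le> ball_weight r z"
  by (simp add: ball_weight_def heis_psi_def)

lemma heis_ball_bounds:
  assumes "r > 0" "z \<in> heis_ball 0 r"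
  shows "norm (fst z) < r" "\<bar>snd z\<bar> < r\<^sup>2"
proof -
  have g: "norm (fst z) ^ 4 + (snd z)\<^sup>2 < r ^ 4"
    using assms by (simp add: mem_heis_ball_0 gauge4_def)
  have "norm (fst z) ^ 4 < r ^ 4" using g zero_le_power2[of "snd z"] by linarith
  then show "norm (fst z) < r"
    using assms(1) by (auto intro: power_less_imp_less_base)
  have "(snd z)\<^sup>2 < r ^ 4"
    using g zero_le_power[OF norm_ge_zero[of "fst z"], of 4] by linarith
  then have "\<bar>snd z\<bar>\<^sup>2 < (r\<^sup>2)\<^sup>2"
    unfolding power2_abs power_mult[symmetric] by simp
  then show "\<bar>snd z\<bar> < r\<^sup>2"
    by (rule power_less_imp_less_base) simp
qed

lemma borel_measurable_ball_weight [measurable]: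
  assumes "r > 0"
  shows "ball_weight r \<in> borel_measurable (borel :: 'n::finite heisenberg measure)"
proof -
  have "(\<lambda>z :: 'n heisenberg. (norm (fst z))\<^sup>2 / sqrt (gauge4 z) * indicator {..<r ^ 4} (gauge4 z)) \<in> borel_measurable borel"
    by simp
  moreover have "ball_weight r = (\<lambda>z :: 'n heisenberg. (norm (fst z))\<^sup>2 / sqrt (gauge4 z) * indicator {..<r ^ 4} (gauge4 z))"
    by (rule ext) (rule ball_weight_gauge4[OF assms])
  ultimately show ?thesis by simp
qed

lemma heis_ball_vol_eq: "heis_ball_vol TYPE('n) r = (\<integral>z. ball_weight r (z :: 'n::finite heisenberg) \<partial>lborel)"
  by (simp add: heis_ball_vol_def ball_weight_def set_lebesgue_integral_def)

text \<open>
  The weighted volume and second moment are homogeneous of degrees \<open>2 n + 2\<close> and \<open>2 n + 4\<close>; the quotient of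
  their coefficients is \<open>2 n\<close> times the constant.
\<close>

lemma ball_weight_moments:
  assumes r: "r > 0"
  shows "integrable lborel (ball_weight r :: 'n::finite heisenberg \<Rightarrow> real)"
    and "integrable lborel (\<lambda>z :: 'n heisenberg. ball_weight r z * (norm (fst z))\<^sup>2)"
    and "heis_ball_vol TYPE('n) r > 0"
    and "(\<integral>z. ball_weight r z * (norm (fst (z :: 'n heisenberg)))\<^sup>2 \<partial>lborel)
      = 2 * real CARD('n) * mean_value_const CARD('n) * r\<^sup>2 * heis_ball_vol TYPE('n) r"
proof -
  define n where "n = CARD('n)"
  have n: "n > 0" by (simp add: n_def)
  define x where "x = (real n + 1) / 2"
  have x: "x > 0" by (simp add: x_def)
  have D: "DIM((real ^ 'n) \<times> (real ^ 'n)) = 2 * n" by (simp add: n_def)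
  obtain \<kappa> where \<kappa>: "\<kappa> > 0" and moment: "\<And>a. a > 0 \<Longrightarrow>
     (\<integral>\<^sup>+z. ennreal (norm (fst z) ^ a / sqrt (gauge4 z) * indicator {..<r ^ 4} (gauge4 (z :: 'n heisenberg))) \<partial>lborel)
       = ennreal (\<kappa> * Gamma ((real (2 * n) + real a) / 4) / ((real (2 * n) + real a) / 4 * Gamma ((real (2 * n) + real a) / 4 + 1 / 2)) * r ^ (2 * n + a))"
    using nn_integral_gauge4_ball[where 'e = "(real ^ 'n) \<times> (real ^ 'n)"] r unfolding D by blast
  define A where "A = \<kappa> * Gamma x / (x * Gamma (x + 1 / 2))"
  define B where "B = \<kappa> * Gamma (x + 1 / 2) / ((x + 1 / 2) * Gamma (x + 1))"
  have pos: "A > 0" "B > 0"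
    using \<kappa> x by (auto simp: A_def B_def intro!: divide_pos_pos mult_pos_pos Gamma_real_pos)
  have args: "(real (2 * n) + real 2) / 4 = x" "(real (2 * n) + real 4) / 4 = x + 1 / 2" "x + 1 / 2 + 1 / 2 = x + 1"
    by (simp_all add: x_def field_simps)
  have "(\<integral>\<^sup>+z. ennreal (ball_weight r (z :: 'n heisenberg)) \<partial>lborel) = ennreal (A * r ^ (2 * n + 2))"
    using moment[of 2] r unfolding args A_def by (simp add: ball_weight_gauge4)
  then have vol: "integrable lborel (ball_weight r :: 'n heisenberg \<Rightarrow> real)"
      "(\<integral>z. ball_weight r (z :: 'n heisenberg) \<partial>lborel) = A * r ^ (2 * n + 2)"
    using r pos by (subst (asm) nn_integral_eq_integrable; simp add: ball_weight_nonneg)+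
  have "(\<integral>\<^sup>+z. ennreal (ball_weight r z * (norm (fst (z :: 'n heisenberg)))\<^sup>2) \<partial>lborel)
     = (\<integral>\<^sup>+z. ennreal (norm (fst z) ^ 4 / sqrt (gauge4 z) * indicator {..<r ^ 4} (gauge4 (z :: 'n heisenberg))) \<partial>lborel)"
    using r by (intro nn_integral_cong) (auto simp: ball_weight_gauge4 power_add[symmetric] split: split_indicator)
  also have "\<dots> = ennreal (B * r ^ (2 * n + 4))"
    using moment[of 4] unfolding args B_def by simp
  finally have mom: "integrable lborel (\<lambda>z :: 'n heisenberg. ball_weight r z * (norm (fst z))\<^sup>2)"
      "(\<integral>z. ball_weight r z * (norm (fst (z :: 'n heisenberg)))\<^sup>2 \<partial>lborel) = B * r ^ (2 * n + 4)"
    using r pos by (subst (asm) nn_integral_eq_integrable; simp add: ball_weight_nonneg)+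
  show "integrable lborel (ball_weight r :: 'n heisenberg \<Rightarrow> real)"
    "integrable lborel (\<lambda>z :: 'n heisenberg. ball_weight r z * (norm (fst z))\<^sup>2)"
    by (fact vol mom)+
  show "heis_ball_vol TYPE('n) r > 0"
    unfolding heis_ball_vol_eq vol using pos r by simp
  have "2 * real n * mean_value_const n = B / A"
    unfolding mean_value_const_Gamma A_def B_def x_def[symmetric] using \<kappa> n by simp
  then have "B = 2 * real n * mean_value_const n * A"
    using pos by (simp add: field_simps)
  then show "(\<integral>z. ball_weight r z * (norm (fst (z :: 'n heisenberg)))\<^sup>2 \<partial>lborel)
      = 2 * real CARD('n) * mean_value_const CARD('n) * r\<^sup>2 * heis_ball_vol TYPE('n) r"
    unfolding mom(2) heis_ball_vol_eq vol(2) n_def[symmetric] by (simp add: power_add eval_nat_numeral)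
qed

text \<open>
  Here the constant gets its meaning: it is the common weighted mean of the squared horizontal
  coordinates over the unit ball.
\<close>

lemma ball_weight_quadratic:
  fixes Q :: "(real ^ 'n::finite) \<times> (real ^ 'n) \<Rightarrow> (real ^ 'n) \<times> (real ^ 'n) \<Rightarrow> real"
  assumes r: "r > 0" and Q: "\<And>k. linear (\<lambda>h. Q h k)" "\<And>h. linear (Q h)"
  shows "integrable lborel (\<lambda>z. ball_weight r z * Q (fst z) (fst z))"
    and "(\<integral>z. ball_weight r z * Q (fst z) (fst z) \<partial>lborel)
      = mean_value_const CARD('n) * r\<^sup>2 * heis_ball_vol TYPE('n) r * (\<Sum>h\<in>Basis. Q h h)"
proof -
  define w where "w s \<tau> = s\<^sup>2 / sqrt (s ^ 4 + \<tau>\<^sup>2) * indicator {..<r ^ 4} (s ^ 4 + \<tau>\<^sup>2)" for s \<tau> :: real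
  have w: "w (norm (fst z)) (snd z) = ball_weight r z" for z :: "'n heisenberg"
    using r by (simp add: w_def ball_weight_gauge4 gauge4_def)
  have m: "(\<lambda>z. w (norm (fst z)) (snd z)) \<in> borel_measurable (borel :: 'n heisenberg measure)"
    unfolding w using borel_measurable_ball_weight[OF r] .
  have sq: "(\<integral>z. ball_weight r z * (fst (z :: 'n heisenberg) \<bullet> h)\<^sup>2 \<partial>lborel)
      = mean_value_const CARD('n) * r\<^sup>2 * heis_ball_vol TYPE('n) r" if "h \<in> Basis" for h
    using integral_square_moment[OF m _ that] ball_weight_moments(2,4)[OF r, where 'n = 'n]
    unfolding w by (simp add: mult_2[symmetric])
  have cross: "(\<integral>z. ball_weight r z * ((fst (z :: 'n heisenberg) \<bullet> h) * (fst z \<bullet> k)) \<partial>lborel) = 0"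
    if "h \<in> Basis" "k \<in> Basis" "h \<noteq> k" for h k
    using integral_cross_moment[OF m that] unfolding w .
  have int: "integrable lborel (\<lambda>z. ball_weight r z * ((fst (z :: 'n heisenberg) \<bullet> h) * (fst z \<bullet> k)))"
    if "h \<in> Basis" "k \<in> Basis" for h k
  proof (rule Bochner_Integration.integrable_bound[OF ball_weight_moments(2)[OF r]])
    show "(\<lambda>z. ball_weight r z * ((fst (z :: 'n heisenberg) \<bullet> h) * (fst z \<bullet> k))) \<in> borel_measurable lborel"
      using borel_measurable_ball_weight[OF r] by (intro borel_measurable_times) auto
    have "\<bar>y \<bullet> h\<bar> * \<bar>y \<bullet> k\<bar> \<le> (norm y)\<^sup>2" for y :: "(real ^ 'n) \<times> (real ^ 'n)"
      unfolding power2_eq_square using Basis_le_norm that by (intro mult_mono) auto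
    then show "AE z in lborel. norm (ball_weight r z * ((fst (z :: 'n heisenberg) \<bullet> h) * (fst z \<bullet> k)))
        \<le> norm (ball_weight r z * (norm (fst z))\<^sup>2)"
      by (intro AE_I2) (auto simp: abs_mult intro!: mult_left_mono)
  qed
  have Q_sum: "ball_weight r z * Q (fst z) (fst z)
      = (\<Sum>h\<in>Basis. \<Sum>k\<in>Basis. Q h k * (ball_weight r z * ((fst z \<bullet> h) * (fst z \<bullet> k))))" for z
  proof -
    have "Q (fst z) (fst z) = (\<Sum>h\<in>Basis. (fst z \<bullet> h) * Q h (fst z))"
      by (rule linear_basis_sum[OF Q(1)])
    also have "\<dots> = (\<Sum>h\<in>Basis. (fst z \<bullet> h) * (\<Sum>k\<in>Basis. (fst z \<bullet> k) * Q h k))"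
      using linear_basis_sum[OF Q(2), of _ "fst z"] by simp
    finally show ?thesis
      by (simp add: sum_distrib_left mult_ac)
  qed
  show "integrable lborel (\<lambda>z. ball_weight r z * Q (fst z) (fst z))"
    unfolding Q_sum using int by (intro Bochner_Integration.integrable_sum integrable_mult_right) auto
  have "(\<integral>z. ball_weight r z * Q (fst z) (fst z) \<partial>lborel)
     = (\<Sum>h\<in>Basis. \<Sum>k\<in>Basis. Q h k * (\<integral>z. ball_weight r z * ((fst (z :: 'n heisenberg) \<bullet> h) * (fst z \<bullet> k)) \<partial>lborel))"
    unfolding Q_sum using int
    by (subst Bochner_Integration.integral_sum; (intro Bochner_Integration.integrable_sum integrable_mult_right sum.cong refl)?; simp?)
  also have "\<dots> = (\<Sum>h\<in>Basis. \<Sum>k\<in>Basis. if k = h then Q h h * (mean_value_const CARD('n) * r\<^sup>2 * heis_ball_vol TYPE('n) r) else 0)"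
    using sq cross by (intro sum.cong refl) (auto simp: power2_eq_square)
  also have "\<dots> = mean_value_const CARD('n) * r\<^sup>2 * heis_ball_vol TYPE('n) r * (\<Sum>h\<in>Basis. Q h h)"
    by (simp add: sum_distrib_right[symmetric] mult.commute)
  finally show "(\<integral>z. ball_weight r z * Q (fst z) (fst z) \<partial>lborel)
      = mean_value_const CARD('n) * r\<^sup>2 * heis_ball_vol TYPE('n) r * (\<Sum>h\<in>Basis. Q h h)" .
qed

lemma integrable_ball_weight_bounded:
  fixes g :: "'n::finite heisenberg \<Rightarrow> real"
  assumes r: "r > 0" and g: "(\<lambda>z. ball_weight r z * g z) \<in> borel_measurable borel"
    and M: "\<And>z. z \<in> heis_ball 0 r \<Longrightarrow> \<bar>g z\<bar> \<le> M"
  shows "integrable lborel (\<lambda>z. ball_weight r z * g z)"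
proof (rule Bochner_Integration.integrable_bound[OF integrable_mult_right[OF ball_weight_moments(1)[OF r], of M]])
  have "\<bar>ball_weight r z * g z\<bar> \<le> M * ball_weight r z" for z
  proof (cases "z \<in> heis_ball 0 r")
    case True
    then show ?thesis
      using mult_right_mono[OF M[OF True] ball_weight_nonneg[of r z]] ball_weight_nonneg[of r z]
      by (simp add: abs_mult mult.commute[of "ball_weight r z"])
  qed (simp add: ball_weight_def)
  then show "AE z in lborel. norm (ball_weight r z * g z) \<le> norm (M * ball_weight r z)"
    by (intro AE_I2) (metis abs_ge_self order_trans real_norm_def)
qed (use g in simp)

lemma ball_weight_linear:
  fixes g :: "'n::finite heisenberg \<Rightarrow> real"
  assumes r: "r > 0" and g: "linear g"
  shows "integrable lborel (\<lambda>z. ball_weight r z * g z)"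
    and "(\<integral>z. ball_weight r z * g z \<partial>lborel) = 0"
proof -
  have m: "(\<lambda>z. ball_weight r z * g z) \<in> borel_measurable borel"
  proof (rule borel_measurable_times[OF borel_measurable_ball_weight[OF r]])
    show "g \<in> borel_measurable borel"
      using g by (intro borel_measurable_continuous_onI linear_continuous_on) (simp add: linear_linear)
  qed
  obtain C where C: "\<And>z. norm (g z) \<le> C * norm z" "C > 0"
    using linear_bounded_pos[OF g] by blast
  show "integrable lborel (\<lambda>z. ball_weight r z * g z)"
  proof (rule integrable_ball_weight_bounded[OF r m, where M = "C * (r + r\<^sup>2)"])
    fix z :: "'n heisenberg" assume z: "z \<in> heis_ball 0 r"
    have "norm z \<le> norm (fst z) + norm (snd z)"
      by (metis norm_Pair_le prod.collapse)
    also have "\<dots> \<le> r + r\<^sup>2"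
      using heis_ball_bounds[OF r z] by simp
    finally show "\<bar>g z\<bar> \<le> C * (r + r\<^sup>2)"
      using C(1)[of z] C(2) by (smt (verit) mult_left_mono real_norm_def)
  qed
  have "ball_weight r (- z) = ball_weight r z" for z :: "'n heisenberg"
    using r by (simp add: ball_weight_gauge4 gauge4_def)
  then have "(\<integral>z. - (ball_weight r z * g z) \<partial>lborel) = (\<integral>z. ball_weight r z * g z \<partial>lborel)"
    using integral_uminus_lborel[OF m] g by (simp add: linear_neg)
  then show "(\<integral>z. ball_weight r z * g z \<partial>lborel) = 0"
    by simp
qed

section \<open>The mean value expansion\<close>

text \<open>
  The extension \<open>f'\<close> serves measurability: \<open>f\<close> itself may be arbitrary outside the ball.
\<close>

lemma heis_avg_eq:
  fixes f :: "'n::finite heisenberg \<Rightarrow> real"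
  assumes r: "r > 0" and f: "f' \<in> borel_measurable borel" and eq: "\<And>y. y \<in> heis_ball x r \<Longrightarrow> f' y = f y"
  shows "heis_avg f x r = (\<integral>z. ball_weight r z * f' (x \<circ>\<^sub>H z) \<partial>lborel) / heis_ball_vol TYPE('n) r"
proof -
  let ?g = "\<lambda>z. ball_weight r z * f' (x \<circ>\<^sub>H z)"
  define k where "k h = - snd x + 2 * (\<Sum>i\<in>UNIV. fst h $ i * snd (- fst x) $ i - fst (- fst x) $ i * snd h $ i)"
    for h :: "(real ^ 'n) \<times> (real ^ 'n)"
  have inv: "heis_inv x \<circ>\<^sub>H y = (fst y + - fst x, snd y + k (fst y))" for y
    by (simp add: heis_mult_def heis_inv_def k_def)
  have k: "k \<in> borel_measurable borel"
    unfolding k_def by (intro borel_measurable_continuous_onI continuous_intros)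
  have "(\<lambda>z. x \<circ>\<^sub>H z) \<in> borel_measurable borel"
    unfolding heis_mult_def by (intro borel_measurable_continuous_onI continuous_intros)
  then have g: "?g \<in> borel_measurable borel"
    using borel_measurable_ball_weight[OF r] f by (intro borel_measurable_times measurable_compose[OF _ f]) auto
  have "(LINT y:heis_ball x r|lborel. heis_psi (heis_inv x \<circ>\<^sub>H y) * f y) = (\<integral>y. ?g (heis_inv x \<circ>\<^sub>H y) \<partial>lborel)"
    unfolding set_lebesgue_integral_def
  proof (rule Bochner_Integration.integral_cong[OF refl])
    fix y
    have "x \<circ>\<^sub>H (heis_inv x \<circ>\<^sub>H y) = y"
      by (simp flip: heis_mult_assoc)
    then show "indicator (heis_ball x r) y *\<^sub>R (heis_psi (heis_inv x \<circ>\<^sub>H y) * f y) = ?g (heis_inv x \<circ>\<^sub>H y)"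
      using eq[of y] by (auto simp: ball_weight_def mem_heis_ball[of y x] split: split_indicator)
  qed
  also have "\<dots> = (\<integral>z. ?g z \<partial>lborel)"
    unfolding inv by (rule integral_shear[OF g k])
  finally show ?thesis
    by (simp add: heis_avg_def)
qed

text \<open>
  The mean of \<open>s - t\<close> over an interval of length \<open>\<tau>\<close> that ends at \<open>t\<close> is \<open>- \<tau> / 2\<close>. Again \<open>g'\<close> is a
  measurable representative, without which the Bochner integral of \<open>g\<close> would have the default value 0.
\<close>

lemma time_average_estimate:
  fixes g :: "real \<Rightarrow> real"
  assumes \<tau>: "\<tau> > 0" and g: "g' \<in> borel_measurable borel" "\<And>s. s \<in> {t - \<tau>..t} \<Longrightarrow> g' s = g s"
    and bound: "\<And>s. s \<in> {t - \<tau>..t} \<Longrightarrow> \<bar>g s - (A + (s - t) * c)\<bar> \<le> \<kappa>"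
  shows "\<bar>1 / \<tau> * (LINT s:{t - \<tau>..t}|lborel. g s) - (A - \<tau> * c / 2)\<bar> \<le> \<kappa>"
proof -
  let ?I = "{t - \<tau>..t}"
  have lin: "set_integrable lborel ?I (\<lambda>s. A + (s - t) * c)"
    by (intro borel_integrable_atLeastAtMost' continuous_intros)
  have const: "set_integrable lborel ?I (\<lambda>s. \<kappa>)"
    by (intro borel_integrable_atLeastAtMost' continuous_intros)
  have diff: "set_integrable lborel ?I (\<lambda>s. g s - (A + (s - t) * c))"
  proof (rule set_integrable_bound[OF const])
    have "set_borel_measurable lborel ?I (\<lambda>s. g' s - (A + (s - t) * c))"
      unfolding set_borel_measurable_def using g(1) by measurable
    moreover have "(\<lambda>s. indicator ?I s *\<^sub>R (g' s - (A + (s - t) * c))) = (\<lambda>s. indicator ?I s *\<^sub>R (g s - (A + (s - t) * c)))"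
      using g(2) by (auto split: split_indicator)
    ultimately show "set_borel_measurable lborel ?I (\<lambda>s. g s - (A + (s - t) * c))"
      unfolding set_borel_measurable_def by simp
    show "AE s in lborel. s \<in> ?I \<longrightarrow> norm (g s - (A + (s - t) * c)) \<le> norm \<kappa>"
      using bound by (intro AE_I2) (force simp: real_norm_def)
  qed
  have "(LINT s:?I|lborel. g s) = (LINT s:?I|lborel. (g s - (A + (s - t) * c)) + (A + (s - t) * c))"
    by simp
  also have "\<dots> = (LINT s:?I|lborel. g s - (A + (s - t) * c)) + (LINT s:?I|lborel. A + (s - t) * c)"
    by (rule set_integral_add(2)[OF diff lin])
  also have "(LINT s:?I|lborel. A + (s - t) * c) = \<tau> * (A - \<tau> * c / 2)"
  proof -
    have "(\<integral>s. (A + (s - t) * c) * indicator ?I s \<partial>lborel) = (A * t + (t - t)\<^sup>2 * c / 2) - (A * (t - \<tau>) + (t - \<tau> - t)\<^sup>2 * c / 2)"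
      using \<tau> by (intro integral_FTC_Icc_real) (auto intro!: derivative_eq_intros continuous_intros)
    then show ?thesis
      by (simp add: set_lebesgue_integral_def mult.commute algebra_simps power2_eq_square)
  qed
  finally have split: "(LINT s:?I|lborel. g s) = (LINT s:?I|lborel. g s - (A + (s - t) * c)) + \<tau> * (A - \<tau> * c / 2)" .
  have "\<bar>LINT s:?I|lborel. g s - (A + (s - t) * c)\<bar> \<le> (LINT s:?I|lborel. \<kappa>)"
  proof -
    have "norm (indicator ?I s *\<^sub>R (g s - (A + (s - t) * c))) \<le> indicator ?I s *\<^sub>R \<kappa>" for s
      using bound[of s] by (auto split: split_indicator)
    then show ?thesis
      unfolding set_lebesgue_integral_def
      using Bochner_Integration.integral_norm_bound_integral[OF diff[unfolded set_integrable_def] const[unfolded set_integrable_def]]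
      by simp
  qed
  also have "\<dots> = \<tau> * \<kappa>"
    using \<tau> by (simp add: set_lebesgue_integral_def)
  finally have "\<bar>1 / \<tau> * (LINT s:?I|lborel. g s - (A + (s - t) * c))\<bar> \<le> \<kappa>"
    using \<tau> by (simp add: abs_mult field_simps)
  then show ?thesis
    unfolding split using \<tau> by (simp add: field_simps)
qed

lemma parabolic_neighbourhood:
  fixes p :: "'a::real_normed_vector"
  assumes S: "open S" "p \<in> S" and K: "K \<ge> 0"
  shows "\<exists>\<delta>>0. \<forall>\<epsilon> h a b. 0 < \<epsilon> \<longrightarrow> \<epsilon> < \<delta> \<longrightarrow> norm h \<le> K * \<epsilon> \<longrightarrow> \<bar>a\<bar> \<le> \<epsilon>\<^sup>2 \<longrightarrow> \<bar>b\<bar> \<le> \<epsilon>\<^sup>2 \<longrightarrow>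
    p + h + a *\<^sub>R v + b *\<^sub>R w \<in> S"
proof -
  obtain r where r: "r > 0" "ball p r \<subseteq> S"
    using S open_contains_ball by blast
  define N where "N = K + norm v + norm w + 1"
  have N: "N > 0" using K by (simp add: N_def add_nonneg_pos)
  show ?thesis
  proof (intro exI[of _ "min 1 (r / N)"] conjI allI impI)
    show "min 1 (r / N) > 0" using r N by simp
    fix \<epsilon> a b :: real and h :: 'a
    assume e: "0 < \<epsilon>" "\<epsilon> < min 1 (r / N)" and h: "norm h \<le> K * \<epsilon>" and a: "\<bar>a\<bar> \<le> \<epsilon>\<^sup>2" and b: "\<bar>b\<bar> \<le> \<epsilon>\<^sup>2"
    have sq: "\<epsilon>\<^sup>2 \<le> \<epsilon>" using e by (simp add: power2_eq_square mult_left_le)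
    have "norm (h + a *\<^sub>R v + b *\<^sub>R w) \<le> norm h + \<bar>a\<bar> * norm v + \<bar>b\<bar> * norm w"
      by (metis norm_scaleR norm_triangle_le norm_triangle_ineq add_right_mono order_trans)
    also have "\<dots> \<le> K * \<epsilon> + \<epsilon> * norm v + \<epsilon> * norm w"
      using h a b sq by (intro add_mono mult_right_mono) auto
    also have "\<dots> < \<epsilon> * N" using e by (simp add: N_def algebra_simps)
    also have "\<dots> < r" using e N by (simp add: pos_less_divide_eq)
    finally have "norm (h + a *\<^sub>R v + b *\<^sub>R w) < r" .
    moreover have "p + k \<in> S" if "norm k < r" for k
      using that r(2) by (auto simp: dist_norm)
    ultimately show "p + h + a *\<^sub>R v + b *\<^sub>R w \<in> S"
      by (simp add: add.assoc)
  qed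
qed

text \<open>
  The expansion behind the theorem, for any open set of space-time. The Taylor polynomial is averaged
  exactly, and the remainder is bounded by \<open>\<eta> \<epsilon>\<^sup>2\<close> on the whole region of integration, so its average is too.
\<close>

lemma mean_value_expansion:
  fixes u :: "real \<times> 'n::finite heisenberg \<Rightarrow> real"
  assumes S: "open S" and u: "smooth_on u S" and p: "(t, x) \<in> S"
  defines "d \<equiv> deriv (\<lambda>s. u (s, x)) t - mean_value_const CARD('n) * sub_laplacian (\<lambda>y. u (t, y)) x"
  shows "(\<lambda>\<epsilon>. u (t, x) - 1 / \<epsilon>\<^sup>2 * (LINT s:{t - \<epsilon>\<^sup>2..t}|lborel. heis_avg (\<lambda>y. u (s, y)) x \<epsilon>) - d / 2 * \<epsilon>\<^sup>2)
           \<in> o[at_right 0](\<lambda>\<epsilon>. \<epsilon>\<^sup>2)"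
proof -
  let ?M = "mean_value_const CARD('n)"
  let ?D = "frechet_derivative u (at (t, x))"
  let ?B = "second_derivative u (t, x)"
  define L :: "(real ^ 'n) \<times> (real ^ 'n) \<Rightarrow> real \<times> 'n heisenberg" where "L h = (0, horizontal_lift x h)" for h
  let ?Z = "(0, (0, 1)) :: real \<times> 'n heisenberg"
  let ?T = "(1, 0) :: real \<times> 'n heisenberg"
  note tw = smooth_imp_twice_differentiable[OF u S p]
  have ud: "u differentiable (at (t, x))"
    using tw unfolding twice_differentiable_at_def by blast
  have D: "linear ?D" using ud by (rule linear_frechet_derivative)
  have L: "linear L"
    using linear_horizontal_lift[of x] by (intro linearI) (auto simp: L_def linear_add linear_scale)
  obtain K where K: "K > 0" "\<And>h. norm (L h) \<le> K * norm h"
    using linear_bounded_pos[OF L] by blast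
  have move: "(s, x \<circ>\<^sub>H z) = (t, x) + L (fst z) + snd z *\<^sub>R ?Z + (s - t) *\<^sub>R ?T" for s z
    by (simp add: L_def heis_mult_horizontal_lift)
  have ut: "deriv (\<lambda>s. u (s, x)) t = ?D ?T"
  proof -
    have "(u has_derivative ?D) (at ((t, x) + 0 *\<^sub>R ?T))"
      unfolding scaleR_zero_left add_0_right by (rule has_frechet_derivative[OF ud])
    then have "((\<lambda>c. u ((t, x) + c *\<^sub>R ?T)) has_real_derivative ?D ?T) (at 0)"
      by (rule line_has_real_derivative)
    moreover have "(t, x) + c *\<^sub>R ?T = (t + c, x)" for c
      by (simp add: prod_eq_iff)
    ultimately have "((\<lambda>c. u (t + c, x)) has_real_derivative ?D ?T) (at 0)"
      by simp
    then have "((\<lambda>s. u (s, x)) has_real_derivative ?D ?T) (at t)"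
      using DERIV_shift[of "\<lambda>s. u (s, x)" "?D ?T" 0 t] by (simp add: add.commute)
    then show ?thesis by (rule DERIV_imp_deriv)
  qed
  have lap: "sub_laplacian (\<lambda>y. u (t, y)) x = (\<Sum>h\<in>Basis. ?B (L h) (L h))"
    using sub_laplacian_eq_trace[OF section_twice_differentiable(1)[OF tw]]
    by (simp add: section_twice_differentiable(2)[OF tw] L_def)
  have "continuous_on S u"
    using u unfolding smooth_on_def by (metis Ck_on.simps(1))
  \<comment> \<open>A Borel function that agrees with \<open>u\<close> on the region of integration; it justifies the substitution and measurability in \<open>s\<close>.\<close>
  define U where "U q = indicator S q * u q" for q
  have U: "U \<in> borel_measurable borel"
    unfolding U_def[abs_def]
    using borel_measurable_continuous_on_indicator[of S u] \<open>continuous_on S u\<close> S by simp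
  show ?thesis
  proof (rule landau_o.smallI)
    fix \<eta> :: real assume \<eta>: "\<eta> > 0"
    obtain \<delta>1 where \<delta>1: "\<delta>1 > 0" and taylor: "\<And>\<epsilon> h a b. 0 < \<epsilon> \<Longrightarrow> \<epsilon> < \<delta>1 \<Longrightarrow> norm h \<le> K * \<epsilon> \<Longrightarrow> \<bar>a\<bar> \<le> \<epsilon>\<^sup>2 \<Longrightarrow> \<bar>b\<bar> \<le> \<epsilon>\<^sup>2 \<Longrightarrow>
        \<bar>u ((t, x) + h + a *\<^sub>R ?Z + b *\<^sub>R ?T) - (u (t, x) + ?D h + ?B h h / 2 + a * ?D ?Z + b * ?D ?T)\<bar> \<le> \<eta> * \<epsilon>\<^sup>2"
      using parabolic_taylor[OF tw \<eta>, of K ?Z ?T] K by (auto simp: less_imp_le)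
    obtain \<delta>2 where \<delta>2: "\<delta>2 > 0" and inside: "\<And>\<epsilon> h a b. 0 < \<epsilon> \<Longrightarrow> \<epsilon> < \<delta>2 \<Longrightarrow> norm h \<le> K * \<epsilon> \<Longrightarrow> \<bar>a\<bar> \<le> \<epsilon>\<^sup>2 \<Longrightarrow> \<bar>b\<bar> \<le> \<epsilon>\<^sup>2 \<Longrightarrow>
        (t, x) + h + a *\<^sub>R ?Z + b *\<^sub>R ?T \<in> S"
      using parabolic_neighbourhood[OF S p, of K ?Z ?T] K by (auto simp: less_imp_le)
    have main: "\<bar>u (t, x) - 1 / \<epsilon>\<^sup>2 * (LINT s:{t - \<epsilon>\<^sup>2..t}|lborel. heis_avg (\<lambda>y. u (s, y)) x \<epsilon>) - d / 2 * \<epsilon>\<^sup>2\<bar> \<le> \<eta> * \<epsilon>\<^sup>2"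
      if e: "0 < \<epsilon>" "\<epsilon> < min \<delta>1 \<delta>2" for \<epsilon>
    proof -
      let ?vol = "heis_ball_vol TYPE('n) \<epsilon>"
      note vol = ball_weight_moments(3)[OF e(1), where 'n = 'n]
      \<comment> \<open>The Taylor polynomial, with its part linear in \<open>z\<close> kept together.\<close>
      define P where "P s z = u (t, x) + (?D (L (fst z)) + snd z * ?D ?Z) + ?B (L (fst z)) (L (fst z)) / 2 + (s - t) * ?D ?T"
        for s and z :: "'n heisenberg"
      define G where "G s = (\<integral>z. ball_weight \<epsilon> z * U (s, x \<circ>\<^sub>H z) \<partial>lborel) / ?vol" for s
      have near: "norm (L (fst z)) \<le> K * \<epsilon>" "\<bar>snd z\<bar> \<le> \<epsilon>\<^sup>2" if "z \<in> heis_ball 0 \<epsilon>" for z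
        using heis_ball_bounds[OF e(1) that] K(1) K(2)[of "fst z"]
        by (auto intro: order_trans mult_left_mono)
      have time: "\<bar>s - t\<bar> \<le> \<epsilon>\<^sup>2" if "s \<in> {t - \<epsilon>\<^sup>2..t}" for s
        using that by auto
      have U_eq: "U (s, x \<circ>\<^sub>H z) = u (s, x \<circ>\<^sub>H z)"
        if "s \<in> {t - \<epsilon>\<^sup>2..t}" "z \<in> heis_ball 0 \<epsilon>" for s z
        using inside[OF e(1) _ near[OF that(2)] time[OF that(1)]] e(2) by (simp add: U_def move)
      have mult_meas: "(\<lambda>q. (fst q, x \<circ>\<^sub>H snd q)) \<in> borel_measurable (borel :: (real \<times> 'n heisenberg) measure)"
        unfolding heis_mult_def by (intro borel_measurable_continuous_onI continuous_intros)
      have U_slice: "(\<lambda>y. U (s, y)) \<in> borel_measurable borel" for s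
        by (rule measurable_compose[OF _ U]) (intro borel_measurable_continuous_onI continuous_intros)
      have avg: "heis_avg (\<lambda>y. u (s, y)) x \<epsilon> = G s" if s: "s \<in> {t - \<epsilon>\<^sup>2..t}" for s
        unfolding G_def
      proof (rule heis_avg_eq[OF e(1) U_slice])
        fix y assume "y \<in> heis_ball x \<epsilon>"
        then have "heis_inv x \<circ>\<^sub>H y \<in> heis_ball 0 \<epsilon>"
          using mem_heis_ball by blast
        from U_eq[OF s this] show "U (s, y) = u (s, y)"
          by (simp flip: heis_mult_assoc)
      qed
      have prod_meas: "(\<lambda>q. ball_weight \<epsilon> (snd q) * U (fst q, x \<circ>\<^sub>H snd q)) \<in> borel_measurable (borel :: (real \<times> 'n heisenberg) measure)"
        using measurable_compose[OF mult_meas U]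
        by (intro borel_measurable_times measurable_compose[OF _ borel_measurable_ball_weight[OF e(1)]]) auto
      have "G \<in> borel_measurable lborel"
      proof -
        have "(\<lambda>s. \<integral>z. ball_weight \<epsilon> z * U (s, x \<circ>\<^sub>H z) \<partial>lborel) \<in> borel_measurable lborel"
          using prod_meas by (intro lborel.borel_measurable_lebesgue_integral) (simp add: lborel_prod case_prod_beta)
        then show ?thesis
          unfolding G_def[abs_def] by simp
      qed
      then have G_meas: "G \<in> borel_measurable borel" by simp
      have G_bound: "\<bar>G s - (u (t, x) + ?M * \<epsilon>\<^sup>2 * (\<Sum>h\<in>Basis. ?B (L h) (L h)) / 2 + (s - t) * ?D ?T)\<bar> \<le> \<eta> * \<epsilon>\<^sup>2"
        if s: "s \<in> {t - \<epsilon>\<^sup>2..t}" for s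
      proof -
        define \<Lambda> where "\<Lambda> z = ?D (L (fst z)) + snd z * ?D ?Z" for z :: "'n heisenberg"
        define q where "q z = ?B (L (fst z)) (L (fst z))" for z :: "'n heisenberg"
        have "linear \<Lambda>"
          unfolding \<Lambda>_def using D L by (intro linearI) (auto simp: linear_add linear_scale algebra_simps)
        note lin_int = ball_weight_linear[OF e(1) this]
        have quad: "linear (\<lambda>h. ?B (L h) (L k))" "linear (\<lambda>k. ?B (L h) (L k))" for h k
          using linear_compose[OF L second_derivative_linear_left[OF tw, of "L k"]]
            linear_compose[OF L second_derivative_linear_right[OF tw, of "L h"]] by (simp_all add: o_def)
        note quad_int = ball_weight_quadratic[OF e(1), of "\<lambda>h k. ?B (L h) (L k)", OF quad, folded q_def]
        note wt_int = ball_weight_moments(1)[OF e(1), where 'n = 'n]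
        have P_eq: "ball_weight \<epsilon> z * P s z = ball_weight \<epsilon> z * (u (t, x) + (s - t) * ?D ?T)
            + ball_weight \<epsilon> z * \<Lambda> z + ball_weight \<epsilon> z * q z * (1 / 2)" for z
          by (simp add: P_def \<Lambda>_def q_def algebra_simps)
        note parts = integrable_mult_left[OF wt_int, of "u (t, x) + (s - t) * ?D ?T"] lin_int(1)
          integrable_mult_left[OF quad_int(1), of "1 / 2"]
        have P_int: "integrable lborel (\<lambda>z. ball_weight \<epsilon> z * P s z)"
          unfolding P_eq using parts by (intro Bochner_Integration.integrable_add)
        have "(\<integral>z. ball_weight \<epsilon> z * P s z \<partial>lborel)
            = (\<integral>z. ball_weight \<epsilon> (z :: 'n heisenberg) * (u (t, x) + (s - t) * ?D ?T) \<partial>lborel)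
              + (\<integral>z. ball_weight \<epsilon> z * \<Lambda> z \<partial>lborel) + (\<integral>z. ball_weight \<epsilon> z * q z * (1 / 2) \<partial>lborel)"
          unfolding P_eq
          by (subst Bochner_Integration.integral_add[OF Bochner_Integration.integrable_add[OF parts(1,2)] parts(3)],
              subst Bochner_Integration.integral_add[OF parts(1,2)], rule refl)
        also have "\<dots> = ?vol * (u (t, x) + (s - t) * ?D ?T)
              + ?M * \<epsilon>\<^sup>2 * ?vol * (\<Sum>h\<in>Basis. ?B (L h) (L h)) * (1 / 2)"
          unfolding lin_int(2) integral_mult_left_zero quad_int(2) heis_ball_vol_eq by simp
        finally have P_val: "(\<integral>z. ball_weight \<epsilon> z * P s z \<partial>lborel)
            = (u (t, x) + ?M * \<epsilon>\<^sup>2 * (\<Sum>h\<in>Basis. ?B (L h) (L h)) / 2 + (s - t) * ?D ?T) * ?vol"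
          by (simp add: algebra_simps)
        have err: "\<bar>U (s, x \<circ>\<^sub>H z) - P s z\<bar> \<le> \<eta> * \<epsilon>\<^sup>2" if z: "z \<in> heis_ball 0 \<epsilon>" for z
        proof -
          have "\<epsilon> < \<delta>1" using e(2) by simp
          from taylor[OF e(1) this near[OF z] time[OF s]]
          have "\<bar>u (s, x \<circ>\<^sub>H z) - (u (t, x) + ?D (L (fst z)) + ?B (L (fst z)) (L (fst z)) / 2
              + snd z * ?D ?Z + (s - t) * ?D ?T)\<bar> \<le> \<eta> * \<epsilon>\<^sup>2"
            unfolding move[symmetric] .
          then show ?thesis
            unfolding U_eq[OF s z] P_def by (simp only: add_ac)
        qed
        have w_err: "\<bar>ball_weight \<epsilon> z * (U (s, x \<circ>\<^sub>H z) - P s z)\<bar> \<le> ball_weight \<epsilon> z * (\<eta> * \<epsilon>\<^sup>2)" for z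
          using err[of z] ball_weight_nonneg[of \<epsilon> z]
          by (cases "z \<in> heis_ball 0 \<epsilon>") (auto simp: abs_mult mult_left_mono ball_weight_def)
        have slice: "(\<lambda>z. ball_weight \<epsilon> z * U (s, x \<circ>\<^sub>H z)) \<in> borel_measurable lborel"
          using measurable_compose[OF _ prod_meas, of "Pair s" borel]
          by (simp add: borel_measurable_continuous_onI continuous_on_Pair)
        have diff_int: "integrable lborel (\<lambda>z. ball_weight \<epsilon> z * (U (s, x \<circ>\<^sub>H z) - P s z))"
        proof (rule Bochner_Integration.integrable_bound[OF integrable_mult_left[OF wt_int, of "\<eta> * \<epsilon>\<^sup>2"]])
          show "(\<lambda>z. ball_weight \<epsilon> z * (U (s, x \<circ>\<^sub>H z) - P s z)) \<in> borel_measurable lborel"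
            using slice borel_measurable_integrable[OF P_int] by (simp add: right_diff_distrib)
          show "AE z in lborel. norm (ball_weight \<epsilon> z * (U (s, x \<circ>\<^sub>H z) - P s z)) \<le> norm (ball_weight \<epsilon> z * (\<eta> * \<epsilon>\<^sup>2))"
            using w_err by (intro AE_I2) (metis abs_ge_self order_trans real_norm_def)
        qed
        have "(\<integral>z. ball_weight \<epsilon> z * U (s, x \<circ>\<^sub>H z) \<partial>lborel)
            = (\<integral>z. ball_weight \<epsilon> z * (U (s, x \<circ>\<^sub>H z) - P s z) + ball_weight \<epsilon> z * P s z \<partial>lborel)"
          by (simp add: right_diff_distrib)
        also have "\<dots> = (\<integral>z. ball_weight \<epsilon> z * (U (s, x \<circ>\<^sub>H z) - P s z) \<partial>lborel) + (\<integral>z. ball_weight \<epsilon> z * P s z \<partial>lborel)"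
          by (rule Bochner_Integration.integral_add[OF diff_int P_int])
        finally have "G s - (u (t, x) + ?M * \<epsilon>\<^sup>2 * (\<Sum>h\<in>Basis. ?B (L h) (L h)) / 2 + (s - t) * ?D ?T)
            = (\<integral>z. ball_weight \<epsilon> z * (U (s, x \<circ>\<^sub>H z) - P s z) \<partial>lborel) / ?vol"
          unfolding G_def P_val using vol by (simp add: add_divide_distrib)
        moreover have "\<bar>\<integral>z. ball_weight \<epsilon> z * (U (s, x \<circ>\<^sub>H z) - P s z) \<partial>lborel\<bar> \<le> \<eta> * \<epsilon>\<^sup>2 * ?vol"
          using w_err Bochner_Integration.integral_norm_bound_integral[OF diff_int integrable_mult_left[OF wt_int, of "\<eta> * \<epsilon>\<^sup>2"]]
          by (simp add: heis_ball_vol_eq mult.commute)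
        then have "\<bar>(\<integral>z. ball_weight \<epsilon> z * (U (s, x \<circ>\<^sub>H z) - P s z) \<partial>lborel) / ?vol\<bar> \<le> \<eta> * \<epsilon>\<^sup>2"
          using vol by (simp add: pos_divide_le_eq)
        ultimately show ?thesis by simp
      qed
      have "\<bar>1 / \<epsilon>\<^sup>2 * (LINT s:{t - \<epsilon>\<^sup>2..t}|lborel. heis_avg (\<lambda>y. u (s, y)) x \<epsilon>)
          - (u (t, x) + ?M * \<epsilon>\<^sup>2 * (\<Sum>h\<in>Basis. ?B (L h) (L h)) / 2 - \<epsilon>\<^sup>2 * ?D ?T / 2)\<bar> \<le> \<eta> * \<epsilon>\<^sup>2"
        using e(1) G_bound avg by (intro time_average_estimate[OF _ G_meas]) auto
      moreover have "u (t, x) - I - d / 2 * \<epsilon>\<^sup>2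
          = - (I - (u (t, x) + ?M * \<epsilon>\<^sup>2 * (\<Sum>h\<in>Basis. ?B (L h) (L h)) / 2 - \<epsilon>\<^sup>2 * ?D ?T / 2))" for I
        unfolding d_def ut lap by (simp add: algebra_simps diff_divide_distrib)
      ultimately show ?thesis
        by (simp only: abs_minus_cancel)
    qed
    show "\<forall>\<^sub>F \<epsilon> in at_right 0. norm (u (t, x) - 1 / \<epsilon>\<^sup>2 * (LINT s:{t - \<epsilon>\<^sup>2..t}|lborel. heis_avg (\<lambda>y. u (s, y)) x \<epsilon>) - d / 2 * \<epsilon>\<^sup>2)
        \<le> \<eta> * norm (\<epsilon>\<^sup>2)"
      unfolding eventually_at_right_field
      using main \<delta>1 \<delta>2 by (intro exI[of _ "min \<delta>1 \<delta>2"]) simp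
  qed
qed

lemma square_in_smallo_iff:
  "(\<lambda>\<epsilon>::real. c * \<epsilon>\<^sup>2) \<in> o[at_right 0](\<lambda>\<epsilon>. \<epsilon>\<^sup>2) \<longleftrightarrow> c = (0::real)"
proof
  assume o: "(\<lambda>\<epsilon>::real. c * \<epsilon>\<^sup>2) \<in> o[at_right 0](\<lambda>\<epsilon>. \<epsilon>\<^sup>2)"
  show "c = 0"
  proof (rule ccontr)
    assume c: "c \<noteq> 0"
    then have "\<forall>\<^sub>F \<epsilon> in at_right (0::real). norm (c * \<epsilon>\<^sup>2) \<le> \<bar>c\<bar> / 2 * norm (\<epsilon>\<^sup>2)"
      using o by (intro landau_o.smallD) auto
    moreover have "\<forall>\<^sub>F \<epsilon> in at_right (0::real). \<epsilon> > 0"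
      by (rule eventually_at_right_less)
    ultimately have "\<forall>\<^sub>F \<epsilon> in at_right (0::real). False"
      by eventually_elim (use c in \<open>simp add: abs_mult\<close>)
    then show False by simp
  qed
qed simp

theorem theorem1p1:
  fixes \<Omega> :: "'n::finite heisenberg set"
    and T :: real
    and u :: "real \<times> 'n heisenberg \<Rightarrow> real"
  assumes "open \<Omega>"
    and "T > 0"
    and "smooth_on u ({0<..<T} \<times> \<Omega>)"
  shows "(\<forall>(t, x) \<in> {0<..<T} \<times> \<Omega>.
            (\<lambda>\<epsilon>. u (t, x)
                  - 1 / \<epsilon>\<^sup>2 * (LINT s:{t - \<epsilon>\<^sup>2..t}|lborel. heis_avg (\<lambda>y. u (s, y)) x \<epsilon>))
              \<in> o[at_right 0](\<lambda>\<epsilon>. \<epsilon>\<^sup>2))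
     \<longleftrightarrow>
         (\<forall>(t, x) \<in> {0<..<T} \<times> \<Omega>.
            deriv (\<lambda>s. u (s, x)) t
              = mean_value_const CARD('n) * sub_laplacian (\<lambda>y. u (t, y)) x)"
proof -
  have S: "open ({0<..<T} \<times> \<Omega>)"
    using assms(1) by (intro open_Times) auto
  have "(\<lambda>\<epsilon>. u (t, x) - 1 / \<epsilon>\<^sup>2 * (LINT s:{t - \<epsilon>\<^sup>2..t}|lborel. heis_avg (\<lambda>y. u (s, y)) x \<epsilon>))
          \<in> o[at_right 0](\<lambda>\<epsilon>. \<epsilon>\<^sup>2)
      \<longleftrightarrow> deriv (\<lambda>s. u (s, x)) t = mean_value_const CARD('n) * sub_laplacian (\<lambda>y. u (t, y)) x"
    (is "?f \<in> _ \<longleftrightarrow> _") if p: "(t, x) \<in> {0<..<T} \<times> \<Omega>" for t x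
  proof -
    define d where "d = deriv (\<lambda>s. u (s, x)) t - mean_value_const CARD('n) * sub_laplacian (\<lambda>y. u (t, y)) x"
    have expansion: "(\<lambda>\<epsilon>. ?f \<epsilon> - d / 2 * \<epsilon>\<^sup>2) \<in> o[at_right 0](\<lambda>\<epsilon>. \<epsilon>\<^sup>2)"
      using mean_value_expansion[OF S assms(3) p] unfolding d_def .
    have "?f \<in> o[at_right 0](\<lambda>\<epsilon>. \<epsilon>\<^sup>2) \<longleftrightarrow> (\<lambda>\<epsilon>. d / 2 * \<epsilon>\<^sup>2) \<in> o[at_right 0](\<lambda>\<epsilon>. \<epsilon>\<^sup>2)"
      using sum_in_smallo(1)[OF expansion, of "\<lambda>\<epsilon>. d / 2 * \<epsilon>\<^sup>2"] sum_in_smallo(2)[OF _ expansion, of ?f]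
      by auto
    then show ?thesis
      unfolding square_in_smallo_iff by (simp add: d_def)
  qed
  then show ?thesis by blast
qed

end
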